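(* If $\mathcal F \subseteq \binom{[n]}{2} \cup \binom{[n]}{3}$ is a saturating antichain of minimum size (among saturating antichains contained in $\binom{[n]}{2} \cup \binom{[n]}{3}$), then $$|\mathcal F| = \left(\frac{3}{8}-o(1)\right)n^2 \qquad (n\to\infty).$$ Moreover, if $\mathcal F=\mathcal F(n) \subseteq \binom{[n]}{2} \cup \binom{[n]}{3}$ are saturating antichains with $|\mathcal F|=(\frac{3}{8}+o(1))n^2$, then there is a partition $[n]=A \cup B \cup C$ with $|A|=|B|=\lfloor n/4 \rfloor$ and a matching $M$ between $A$ and $B$ such that, if $\mathcal G=\mathcal G_2 \cup \mathcal G_3$ is defined by $$\mathcal G_3=\left\{G \in \binom{[n]}{3}: G \cap C \ne \emptyset \text{ and there exists } m \in M \text{ with } m \subset G\right\},\qquad \mathcal G_2=\binom{[n]}{2} \setminus \Delta(\mathcal G_3),$$ then $|\mathcal G \vartriangle \mathcal F|=o(n^2)$ holds and $\mathcal G$ is a saturating antichain.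
   Context: Write $[n]=\{1,\dots,n\}$, and $\binom{[n]}{l}$ for the family of all $l$-element subsets of $[n]$. An antichain is a family of sets none of which properly contains another. A family $\mathcal F\subseteq 2^{[n]}$ is a saturating antichain if it is an antichain and every $S\in 2^{[n]}\setminus\mathcal F$ is comparable by inclusion with some member of $\mathcal F$ (so no set can be added keeping the antichain property). For a family $\mathcal H\subseteq\binom{[n]}{l}$, $\Delta(\mathcal H)=\{G\in\binom{[n]}{l-1}: \exists F\in\mathcal H \text{ such that } G\subset F\}$. A matching $M$ between $A$ and $B$ is a set of pairwise disjoint 2-element sets $\{a,b\}$ with $a\in A$, $b\in B$. $\vartriangle$ denotes symmetric difference. All $o(\cdot)$ terms refer to $n\to\infty$. *)

theory Defs
  imports "HOL-Library.Landau_Symbols" "HOL-Library.Ramsey" "HOL-Library.Disjoint_Sets"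
begin

definition antichain :: "'a set set \<Rightarrow> bool" where
  "antichain F \<longleftrightarrow> (\<forall>S\<in>F. \<forall>T\<in>F. \<not> S \<subset> T)"

definition saturating_antichain :: "'a set \<Rightarrow> 'a set set \<Rightarrow> bool" where
  "saturating_antichain X F \<longleftrightarrow>
     F \<subseteq> Pow X \<and> antichain F \<and> (\<forall>S \<in> Pow X - F. \<exists>T\<in>F. S \<subseteq> T \<or> T \<subseteq> S)"

definition saturating_antichain_2_3 :: "nat \<Rightarrow> nat set set \<Rightarrow> bool" where
  "saturating_antichain_2_3 n F \<longleftrightarrow>
     F \<subseteq> nsets {1..n} 2 \<union> nsets {1..n} 3 \<and> saturating_antichain {1..n} F"

text \<open>The shadow \<open>\<Delta>(H)\<close> of a family \<open>H\<close> of \<open>l\<close>-element subsets of \<open>X\<close>.\<close>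

definition shadow :: "'a set \<Rightarrow> nat \<Rightarrow> 'a set set \<Rightarrow> 'a set set" where
  "shadow X l H = {G \<in> nsets X (l - 1). \<exists>F\<in>H. G \<subset> F}"

definition matching_between :: "'a set \<Rightarrow> 'a set \<Rightarrow> 'a set set \<Rightarrow> bool" where
  "matching_between A B M \<longleftrightarrow>
     (\<forall>e\<in>M. \<exists>a\<in>A. \<exists>b\<in>B. a \<noteq> b \<and> e = {a, b}) \<and> disjoint M"

definition matching_triples :: "nat \<Rightarrow> nat set \<Rightarrow> nat set set \<Rightarrow> nat set set" where
  "matching_triples n C M = {G \<in> nsets {1..n} 3. G \<inter> C \<noteq> {} \<and> (\<exists>m\<in>M. m \<subset> G)}"

definition matching_pairs :: "nat \<Rightarrow> nat set \<Rightarrow> nat set set \<Rightarrow> nat set set" where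
  "matching_pairs n C M = nsets {1..n} 2 - shadow {1..n} 3 (matching_triples n C M)"

definition matching_family :: "nat \<Rightarrow> nat set \<Rightarrow> nat set set \<Rightarrow> nat set set" where
  "matching_family n C M = matching_pairs n C M \<union> matching_triples n C M"

end

theory Submission
  imports Defs "HOL-Analysis.Convex"
begin

text \<open>The pairs outside a saturating antichain \<open>F\<close> form a graph \<open>E\<close> on \<open>n\<close> vertices in which every edge lies in
  a triangle, the triples of \<open>F\<close> are exactly the triangles of \<open>E\<close>, and \<open>card F = (n choose 2) - e + t\<close>.
  So one has to show \<open>e - t \<le> (1/8 + o(1)) n\<^sup>2\<close> when \<open>t = O(n\<^sup>2)\<close>. No removal lemma is needed. All but
  \<open>\<epsilon> n\<^sup>2\<close> edges are light, that is, lie in at most \<open>\<epsilon> n\<close> triangles. Take a maximal edge-disjoint family of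
  \<open>d\<close> triangles of light edges, and let \<open>Q\<close> be the set of the remaining \<open>q\<close> light edges. Then \<open>Q\<close> is
  triangle-free, and each triangle outside the family contains at most two edges of \<open>Q\<close>, so
  \<open>t \<ge> d + q/2\<close>. The degrees along a light edge or along a light triangle sum to at most \<open>(1 + O(\<epsilon>)) n\<close>,
  so Cauchy-Schwarz gives \<open>4 s\<^sup>2 \<le> n\<^sup>2 (q + 2 d) + O(\<epsilon>) n\<^sup>4\<close> for \<open>s = 3 d + q\<close>, and hence
  \<open>e - t \<le> n\<^sup>2/8 + O(\<epsilon>) n\<^sup>2 - 2 (s/n - n/4)\<^sup>2\<close>.

  Near equality forces \<open>q \<approx> n\<^sup>2/4\<close>, so \<open>Q\<close> is almost complete bipartite with sides \<open>X\<close>, \<open>Y\<close>. Almost every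
  cross pair is then an edge in exactly one triangle. Therefore the edges of \<open>E\<close> between typical vertices of
  one side form a matching, the two matchings cannot both be large, and together they must explain the
  triangles of almost all cross edges. So one of them covers almost a whole side.\<close>

section \<open>Degrees, codegrees and triangles\<close>

definition degree_in :: "'a set set \<Rightarrow> 'a \<Rightarrow> nat" where
  "degree_in E v = card {u. {u, v} \<in> E}"

text \<open>The number of common neighbours of all vertices in \<open>f\<close>. Taking a set rather
  than two vertices lets sums run over edges directly. For \<open>f = {}\<close> the set is the
  whole type, hence the nonemptiness side conditions below.\<close>

definition codegree :: "'a set set \<Rightarrow> 'a set \<Rightarrow> nat" where
  "codegree E f = card {u. \<forall>v\<in>f. {u, v} \<in> E}"

definition triangles :: "'a set set \<Rightarrow> 'a set set" where
  "triangles E = {T. finite T \<and> card T = 3 \<and> nsets T 2 \<subseteq> E}"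

lemma finite_edges: "finite V \<Longrightarrow> E \<subseteq> nsets V 2 \<Longrightarrow> finite E"
  using finite_imp_finite_nsets finite_subset by blast

lemma edge_ends: "E \<subseteq> nsets V 2 \<Longrightarrow> {u, v} \<in> E \<Longrightarrow> u \<in> V \<and> v \<in> V \<and> u \<noteq> v"
  by (drule (1) subsetD) simp

lemma nsets_2_triple:
  "nsets {x, y, z} 2 = {{x, y}, {x, z}, {y, z}}" if "x \<noteq> y" "x \<noteq> z" "y \<noteq> z"
  using that by (auto simp: nsets_2_eq)

lemma card_3E:
  assumes "card T = 3"
  obtains x y z where "T = {x, y, z}" "x \<noteq> y" "x \<noteq> z" "y \<noteq> z"
  using assms by (auto simp: card_3_iff)

lemma triangles_iff:
  assumes "x \<noteq> y" "x \<noteq> z" "y \<noteq> z"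
  shows "{x, y, z} \<in> triangles E \<longleftrightarrow> {x, y} \<in> E \<and> {x, z} \<in> E \<and> {y, z} \<in> E"
  using assms by (simp add: triangles_def nsets_2_triple)

lemma trianglesE:
  assumes "T \<in> triangles E"
  obtains x y z where "T = {x, y, z}" "x \<noteq> y" "x \<noteq> z" "y \<noteq> z" "{x, y} \<in> E" "{x, z} \<in> E" "{y, z} \<in> E"
proof -
  have "card T = 3" using assms by (simp add: triangles_def)
  then obtain x y z where T: "T = {x, y, z}" "x \<noteq> y" "x \<noteq> z" "y \<noteq> z"
    by (rule card_3E)
  moreover have "{x, y} \<in> E" "{x, z} \<in> E" "{y, z} \<in> E"
    using assms triangles_iff[OF T(2-4)] T(1) by auto
  ultimately show ?thesis by (rule that)
qed

lemma triangles_subset: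
  assumes "E \<subseteq> nsets V 2"
  shows "triangles E \<subseteq> nsets V 3"
proof
  fix T assume "T \<in> triangles E"
  then show "T \<in> nsets V 3"
    using assms by (elim trianglesE) (auto simp: nsets_def card_insert_if)
qed

lemma finite_triangles: "finite V \<Longrightarrow> E \<subseteq> nsets V 2 \<Longrightarrow> finite (triangles E)"
  using triangles_subset finite_imp_finite_nsets finite_subset by metis

lemma triangles_mono: "E \<subseteq> E' \<Longrightarrow> triangles E \<subseteq> triangles E'"
  by (auto simp: triangles_def)

lemma card_nsets_2_triangle:
  "T \<in> triangles E \<Longrightarrow> card (nsets T 2) = 3"
  by (simp add: triangles_def card_nsets choose_two)

lemma edge_nsets: "E \<subseteq> nsets V 2 \<Longrightarrow> f \<in> E \<Longrightarrow> f \<subseteq> T \<longleftrightarrow> f \<in> nsets T 2"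
  by (auto simp: nsets_def)

text \<open>Adding a common neighbour \<open>u\<close> to the edge is a bijection onto the triangles
  through it; \<open>u\<close> differs from \<open>x\<close> and \<open>y\<close> because
  \<open>E\<close> has no loops.\<close>

lemma codegree_eq_triangles:
  assumes "finite V" "E \<subseteq> nsets V 2" "{x, y} \<in> E"
  shows "codegree E {x, y} = card {T \<in> triangles E. {x, y} \<subseteq> T}"
proof -
  have ne: "u \<noteq> v" if "{u, v} \<in> E" for u v
    using edge_ends[OF assms(2) that] by simp
  then have xy: "x \<noteq> y" using assms(3) by blast
  have "bij_betw (\<lambda>u. {u, x, y}) {u. \<forall>v\<in>{x, y}. {u, v} \<in> E} {T \<in> triangles E. {x, y} \<subseteq> T}"
  proof (rule bij_betwI')
    fix u w assume "u \<in> {u. \<forall>v\<in>{x, y}. {u, v} \<in> E}" "w \<in> {u. \<forall>v\<in>{x, y}. {u, v} \<in> E}"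
    then have "u \<noteq> x" "u \<noteq> y" "w \<noteq> x" "w \<noteq> y"
      using ne[of u x] ne[of u y] ne[of w x] ne[of w y] by blast+
    then show "({u, x, y} = {w, x, y}) = (u = w)" by auto
  next
    fix u assume "u \<in> {u. \<forall>v\<in>{x, y}. {u, v} \<in> E}"
    moreover from this have "u \<noteq> x" "u \<noteq> y"
      using ne[of u x] ne[of u y] by blast+
    ultimately show "{u, x, y} \<in> {T \<in> triangles E. {x, y} \<subseteq> T}"
      using assms(3) xy by (simp add: triangles_iff)
  next
    fix T assume T: "T \<in> {T \<in> triangles E. {x, y} \<subseteq> T}"
    then have "card (T - {x, y}) = 1"
      using xy by (simp add: triangles_def card_Diff_subset)
    then obtain u where u: "T - {x, y} = {u}" by (auto simp: card_1_singleton_iff)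
    then have "T = {u, x, y}" "u \<noteq> x" "u \<noteq> y" using T by auto
    then show "\<exists>u\<in>{u. \<forall>v\<in>{x, y}. {u, v} \<in> E}. T = {u, x, y}"
      using T xy by (auto simp: triangles_iff)
  qed
  then show ?thesis unfolding codegree_def by (rule bij_betw_same_card)
qed

lemma finite_nbhd:
  assumes "finite V" "E \<subseteq> nsets V 2"
  shows "finite {u. {u, v} \<in> E}"
proof (rule finite_subset)
  show "{u. {u, v} \<in> E} \<subseteq> V"
    using edge_ends[OF assms(2)] by auto
qed (fact assms(1))

text \<open>Double counting of the incidences between edges in \<open>P\<close> and triangles of
  \<open>E\<close>.\<close>

lemma sum_codegree:
  assumes "finite V" "E \<subseteq> nsets V 2" "P \<subseteq> E"
  shows "(\<Sum>f\<in>P. codegree E f) = (\<Sum>T\<in>triangles E. card (P \<inter> nsets T 2))"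
proof -
  have "finite P" using assms finite_edges finite_subset by metis
  have "(\<Sum>f\<in>P. codegree E f) = (\<Sum>f\<in>P. card {T \<in> triangles E. f \<subseteq> T})"
  proof (rule sum.cong)
    fix f assume "f \<in> P"
    then have f: "f \<in> E" using assms by blast
    then obtain x y where xy: "f = {x, y}" using assms by (meson nsets2_E subsetD)
    show "codegree E f = card {T \<in> triangles E. f \<subseteq> T}"
      using codegree_eq_triangles[OF assms(1,2), of x y] f unfolding xy by simp
  qed simp
  also have "\<dots> = (\<Sum>T\<in>triangles E. card (P \<inter> nsets T 2))"
  proof (rule sum_multicount_gen)
    show "\<forall>T\<in>triangles E. card {f \<in> P. f \<subseteq> T} = card (P \<inter> nsets T 2)"
      using assms(2,3) by (auto intro!: arg_cong[where f = card] simp: nsets_def)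
  qed (use assms \<open>finite P\<close> finite_triangles in auto)
  finally show ?thesis .
qed

text \<open>A vertex with \<open>k\<close> neighbours in \<open>S\<close> lies in the common neighbourhood of \<open>k choose 2\<close> pairs, and
  \<open>k \<le> 1 + (k choose 2)\<close>.\<close>

lemma sum_degree_le:
  assumes V: "finite V" "E \<subseteq> nsets V 2" and S: "finite S"
  shows "(\<Sum>v\<in>S. degree_in E v) \<le> card V + (\<Sum>f\<in>nsets S 2. codegree E f)"
proof -
  have sub: "u \<in> V" if "{u, v} \<in> E" for u v
    using edge_ends[OF V(2) that] by simp
  have "(\<Sum>v\<in>S. degree_in E v) = (\<Sum>v\<in>S. card {u \<in> V. {u, v} \<in> E})"
    unfolding degree_in_def using sub by (intro sum.cong arg_cong[where f = card]) auto
  also have "\<dots> = (\<Sum>u\<in>V. card {v \<in> S. {u, v} \<in> E})"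
    by (rule sum_multicount_gen) (use assms in auto)
  also have "\<dots> \<le> (\<Sum>u\<in>V. 1 + card {f \<in> nsets S 2. \<forall>v\<in>f. {u, v} \<in> E})"
  proof (rule sum_mono)
    fix u assume "u \<in> V"
    let ?W = "{v \<in> S. {u, v} \<in> E}"
    have "nsets ?W 2 = {f \<in> nsets S 2. \<forall>v\<in>f. {u, v} \<in> E}"
      by (auto simp: nsets_def)
    then have eq: "card {f \<in> nsets S 2. \<forall>v\<in>f. {u, v} \<in> E} = card ?W choose 2"
      using S by (metis (no_types, lifting) card_nsets)
    have "k \<le> 1 + (k choose 2)" for k
      by (induction k) (auto simp: numeral_2_eq_2)
    from this[of "card ?W"] show "card ?W \<le> 1 + card {f \<in> nsets S 2. \<forall>v\<in>f. {u, v} \<in> E}"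
      unfolding eq .
  qed
  also have "\<dots> = card V + (\<Sum>u\<in>V. card {f \<in> nsets S 2. \<forall>v\<in>f. {u, v} \<in> E})"
    by (simp only: sum.distrib card_eq_sum)
  also have "(\<Sum>u\<in>V. card {f \<in> nsets S 2. \<forall>v\<in>f. {u, v} \<in> E})
      = (\<Sum>f\<in>nsets S 2. card {u \<in> V. \<forall>v\<in>f. {u, v} \<in> E})"
    by (rule sum_multicount_gen) (use assms finite_imp_finite_nsets in auto)
  also have "\<dots> = (\<Sum>f\<in>nsets S 2. codegree E f)"
  proof (rule sum.cong)
    fix f :: "'a set" assume "f \<in> nsets S 2"
    then have "f \<noteq> {}" by (auto simp: nsets_def)
    then show "card {u \<in> V. \<forall>v\<in>f. {u, v} \<in> E} = codegree E f"
      unfolding codegree_def using sub by (intro arg_cong[where f = card]) auto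
  qed simp
  finally show ?thesis .
qed

lemma card_incident:
  assumes "E \<subseteq> nsets V 2"
  shows "card {f \<in> E. v \<in> f} = degree_in E v"
proof -
  have "bij_betw (\<lambda>u. {u, v}) {u. {u, v} \<in> E} {f \<in> E. v \<in> f}"
  proof (rule bij_betwI')
    fix f assume f: "f \<in> {f \<in> E. v \<in> f}"
    then have "f \<in> nsets V 2" using assms by auto
    then obtain x y where xy: "f = {x, y}" by (rule nsets2_E)
    define w where "w = (if v = x then y else x)"
    have "f = {w, v}" using f unfolding xy w_def by auto
    with f show "\<exists>u\<in>{u. {u, v} \<in> E}. f = {u, v}" by auto
  qed (auto simp: doubleton_eq_iff)
  from bij_betw_same_card[OF this] show ?thesis by (simp add: degree_in_def)
qed

lemma sum_edges_weight:
  assumes V: "finite V" "E \<subseteq> nsets V 2"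
  shows "(\<Sum>f\<in>E. \<Sum>v\<in>f. g v) = (\<Sum>v\<in>V. real (degree_in E v) * g v)"
proof -
  have "finite E" using V finite_edges by blast
  have "(\<Sum>f\<in>E. \<Sum>v\<in>f. g v) = (\<Sum>f\<in>E. \<Sum>v | v \<in> V \<and> v \<in> f. g v)"
    using V by (intro sum.cong) (auto simp: nsets_def)
  also have "\<dots> = (\<Sum>v\<in>V. \<Sum>f | f \<in> E \<and> v \<in> f. g v)"
    using V \<open>finite E\<close> by (intro sum.swap_restrict)
  also have "\<dots> = (\<Sum>v\<in>V. real (degree_in E v) * g v)"
    using card_incident[OF V(2)] by simp
  finally show ?thesis .
qed

lemma sum_degree:
  assumes V: "finite V" "E \<subseteq> nsets V 2"
  shows "(\<Sum>v\<in>V. real (degree_in E v)) = 2 * real (card E)"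
proof -
  have "(\<Sum>v\<in>V. real (degree_in E v)) = (\<Sum>f\<in>E. \<Sum>v\<in>f. 1)"
    using sum_edges_weight[OF V, of "\<lambda>_. 1"] by simp
  also have "\<dots> = (\<Sum>f\<in>E. 2)"
    using V by (intro sum.cong) (auto simp: nsets_def)
  finally show ?thesis by simp
qed

text \<open>Summing the degree sums of edges gives the sum of squared degrees, so this is
  Cauchy-Schwarz combined with the handshake identity \<open>sum_degree\<close>.\<close>

lemma sum_edges_degree_ge:
  assumes V: "finite V" "E \<subseteq> nsets V 2"
  shows "4 * (real (card E))\<^sup>2 \<le> real (card V) * (\<Sum>f\<in>E. \<Sum>v\<in>f. real (degree_in E v))"
proof -
  have "(\<Sum>v\<in>V. real (degree_in E v))\<^sup>2 \<le> (\<Sum>v\<in>V. (real (degree_in E v))\<^sup>2) * card V"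
    by (rule sum_squared_le_sum_of_squares)
  then show ?thesis
    unfolding sum_edges_weight[OF V] sum_degree[OF V]
    by (simp add: power2_eq_square mult.commute)
qed

section \<open>Packing light triangles\<close>

declare card_nsets [simp del]

lemma codegree_mono:
  assumes "finite V" "E \<subseteq> nsets V 2" "L \<subseteq> E" "f \<noteq> {}"
  shows "codegree L f \<le> codegree E f"
proof -
  obtain v where "v \<in> f" using assms(4) by blast
  then have "{u. \<forall>v\<in>f. {u, v} \<in> E} \<subseteq> {u. {u, v} \<in> E}" by blast
  then have "finite {u. \<forall>v\<in>f. {u, v} \<in> E}"
    using finite_nbhd[OF assms(1,2), of v] finite_subset by blast
  then show ?thesis
    unfolding codegree_def using assms(3) by (intro card_mono) auto
qed

text \<open>An inclusion-maximal edge-disjoint family works: a triangle left over after deleting its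
  edges could be added to it.\<close>

lemma edge_disjoint_triangles_exist:
  assumes V: "finite V" "E \<subseteq> nsets V 2"
  obtains D where "D \<subseteq> triangles E" "disjoint_family_on (\<lambda>T. nsets T 2) D"
    "triangles (E - (\<Union>T\<in>D. nsets T 2)) = {}"
proof -
  let ?S = "{D. D \<subseteq> triangles E \<and> disjoint_family_on (\<lambda>T. nsets T 2) D}"
  have "finite ?S" using finite_triangles[OF V] by simp
  moreover have "?S \<noteq> {}" by (auto intro!: exI[of _ "{}"] simp: disjoint_family_on_def)
  ultimately have "\<exists>D\<in>?S. \<forall>D'\<in>?S. D \<subseteq> D' \<longrightarrow> D = D'"
    by (rule finite_has_maximal)
  then obtain D where D: "D \<in> ?S" and "\<forall>D'\<in>?S. D \<subseteq> D' \<longrightarrow> D = D'" ..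
  then have max: "D = D'" if "D' \<in> ?S" "D \<subseteq> D'" for D'
    using that by simp
  have "T \<notin> triangles (E - (\<Union>T\<in>D. nsets T 2))" for T
  proof
    assume T: "T \<in> triangles (E - (\<Union>T\<in>D. nsets T 2))"
    then have TE: "T \<in> triangles E" using triangles_mono[of "E - _" E] by blast
    have T_disj: "nsets T 2 \<inter> (\<Union>T\<in>D. nsets T 2) = {}"
      using T by (auto simp: triangles_def)
    have "nsets T 2 \<noteq> {}" using card_nsets_2_triangle[OF TE] by auto
    then have "T \<notin> D" using T_disj by blast
    have "insert T D \<in> ?S"
      using D TE T_disj \<open>T \<notin> D\<close> by (auto simp: disjoint_family_on_insert)
    then have "D = insert T D" by (rule max) blast
    then show False using \<open>T \<notin> D\<close> by blast
  qed
  then have "triangles (E - (\<Union>T\<in>D. nsets T 2)) = {}" by blast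
  then show ?thesis using that[of D] D by simp
qed

lemma sum_nsets_2_triangle:
  assumes "T \<in> triangles E"
  shows "(\<Sum>f\<in>nsets T 2. \<Sum>v\<in>f. (g v :: real)) = 2 * (\<Sum>v\<in>T. g v)"
  using assms
proof (rule trianglesE)
  fix x y z assume T: "T = {x, y, z}" "x \<noteq> y" "x \<noteq> z" "y \<noteq> z"
  then have "{x, y} \<noteq> {x, z}" "{x, y} \<noteq> {y, z}" "{x, z} \<noteq> {y, z}"
    by (auto simp: doubleton_eq_iff)
  then show ?thesis
    unfolding T(1) nsets_2_triple[OF T(2-4)] using T(2-4) by simp
qed

text \<open>Markov's inequality: the codegrees sum to at most three times the number of triangles,
  hence to at most \<open>3/2 * n^2\<close>, and the lower bound on \<open>n\<close> turns this into
  \<open>\<epsilon>^2 * n^3\<close>.\<close>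

lemma card_heavy_edges:
  fixes n \<epsilon> :: real
  assumes V: "finite V" "E \<subseteq> nsets V 2" and \<epsilon>: "\<epsilon> > 0"
    and n: "n = real (card V)" "3 \<le> 2 * \<epsilon>\<^sup>2 * n"
    and t: "2 * real (card (triangles E)) \<le> n\<^sup>2"
  shows "real (card {f \<in> E. codegree E f > \<epsilon> * n}) \<le> \<epsilon> * n\<^sup>2"
proof -
  let ?H = "{f \<in> E. codegree E f > \<epsilon> * n}"
  have "n > 0" using n by (cases "card V = 0") auto
  have "finite ?H" using finite_edges[OF V] by simp
  have "real (card ?H) * (\<epsilon> * n) \<le> (\<Sum>f\<in>?H. real (codegree E f))"
    by (rule sum_bounded_below) auto
  also have "\<dots> = real (\<Sum>T\<in>triangles E. card (?H \<inter> nsets T 2))"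
    by (subst sum_codegree[OF V, of ?H, symmetric]) auto
  also have "\<dots> \<le> real (\<Sum>T\<in>triangles E. 3)"
  proof (intro of_nat_mono sum_mono)
    fix T assume T: "T \<in> triangles E"
    then have "card (?H \<inter> nsets T 2) \<le> card (nsets T 2)"
      using card_nsets_2_triangle[OF T] by (intro card_mono) (auto intro: card_ge_0_finite)
    then show "card (?H \<inter> nsets T 2) \<le> 3" using card_nsets_2_triangle[OF T] by simp
  qed
  also have "\<dots> \<le> (3 / 2) * n\<^sup>2" using t by simp
  also have "\<dots> \<le> \<epsilon>\<^sup>2 * n * n\<^sup>2"
    using n(2) by (intro mult_right_mono) auto
  finally have "real (card ?H) * (\<epsilon> * n) \<le> (\<epsilon> * n\<^sup>2) * (\<epsilon> * n)"
    by (simp add: power2_eq_square algebra_simps)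
  then show ?thesis
    by (rule mult_right_le_imp_le) (use \<open>n > 0\<close> \<epsilon> in simp)
qed

text \<open>\<open>d\<close> is the size of a maximal packing of light triangles and
  \<open>Q\<close> the set of light edges it misses. The last bound carries the gain: the three
  edges of a packed triangle have total degree sum about \<open>2 * n\<close> instead of
  \<open>3 * n\<close>, since its three vertices together have degree only about
  \<open>n\<close>.\<close>

lemma triangle_free_part:
  fixes n \<epsilon> :: real
  assumes V: "finite V" "E \<subseteq> nsets V 2" and \<epsilon>: "\<epsilon> > 0"
    and cov: "\<forall>f\<in>E. \<exists>T\<in>triangles E. f \<subseteq> T"
    and n: "n = real (card V)" "3 \<le> 2 * \<epsilon>\<^sup>2 * n"
    and t: "2 * real (card (triangles E)) \<le> n\<^sup>2"
  obtains Q d where "Q \<subseteq> E" "triangles Q = {}"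
    "real (card E) \<le> \<epsilon> * n\<^sup>2 + 3 * real d + real (card Q)"
    "real d + real (card Q) / 2 \<le> real (card (triangles E))"
    "4 * (3 * real d + real (card Q))\<^sup>2
       \<le> n * (real (card Q) * (n + \<epsilon> * n) + 2 * real d * (n + 3 * \<epsilon> * n))"
proof -
  let ?H = "{f \<in> E. codegree E f > \<epsilon> * n}"
  define L where "L = E - ?H"
  have fE: "finite E" using finite_edges[OF V] .
  have LE: "L \<subseteq> E" and LV: "L \<subseteq> nsets V 2" using V(2) by (auto simp: L_def)
  have fL: "finite L" using fE LE finite_subset by blast
  obtain D where D: "D \<subseteq> triangles L" and disj: "disjoint_family_on (\<lambda>T. nsets T 2) D"
    and free: "triangles (L - (\<Union>T\<in>D. nsets T 2)) = {}"
    using edge_disjoint_triangles_exist[OF V(1) LV] .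
  define P where "P = (\<Union>T\<in>D. nsets T 2)"
  define Q where "Q = L - P"
  have DE: "D \<subseteq> triangles E" using D triangles_mono[OF LE] by blast
  have fD: "finite D" using DE finite_triangles[OF V] finite_subset by blast
  have PL: "P \<subseteq> L" using D by (auto simp: P_def triangles_def)
  have fin2: "finite (nsets T 2)" if "T \<in> D" for T
    using that D by (auto simp: triangles_def finite_imp_finite_nsets)
  have cP: "card P = 3 * card D"
  proof -
    have "card P = (\<Sum>T\<in>D. card (nsets T 2))"
      unfolding P_def using fD fin2 disj
      by (intro card_UN_disjoint) (auto simp: disjoint_family_on_def)
    also have "\<dots> = (\<Sum>T\<in>D. 3)"
      using D card_nsets_2_triangle by (intro sum.cong) blast+
    finally show ?thesis by simp
  qed
  have "card L = card P + card Q"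
    unfolding Q_def using PL fL finite_subset[OF PL fL] card_mono[OF fL PL] by (simp add: card_Diff_subset)
  then have cL: "real (card L) = 3 * real (card D) + real (card Q)" using cP by simp
  have "card E = card ?H + card L"
    unfolding L_def using fE card_mono[OF fE, of ?H] by (subst card_Diff_subset) auto
  then have cE: "real (card E) \<le> \<epsilon> * n\<^sup>2 + 3 * real (card D) + real (card Q)"
    using card_heavy_edges[OF V \<epsilon> n t] cL by simp

  have QE: "Q \<subseteq> E" using LE by (auto simp: Q_def)
  have fQ: "finite Q" using fL by (simp add: Q_def)
  have Qfree: "triangles Q = {}" using free by (simp add: Q_def P_def)
  have fT: "finite (triangles E)" using finite_triangles[OF V] .
  \<comment> \<open>Double counting of pairs of an edge of \<open>Q\<close> and a triangle outside
    \<open>D\<close> containing it. Every edge of \<open>Q\<close> lies in some triangle by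
    \<open>cov\<close>, and never in one of \<open>D\<close>, whose edges were removed; a triangle
    has at most two edges in the triangle-free \<open>Q\<close>.\<close>
  have "card Q = (\<Sum>f\<in>Q. 1)" by simp
  also have "\<dots> \<le> (\<Sum>f\<in>Q. card {T \<in> triangles E - D. f \<subseteq> T})"
  proof (rule sum_mono)
    fix f assume f: "f \<in> Q"
    then obtain T where T: "T \<in> triangles E" "f \<subseteq> T" using cov QE by blast
    have "T \<notin> D"
    proof
      assume "T \<in> D"
      moreover have "f \<in> nsets T 2" using f T(2) QE edge_nsets[OF V(2), of f T] by blast
      ultimately have "f \<in> P" by (auto simp: P_def)
      then show False using f by (simp add: Q_def)
    qed
    then have "T \<in> {T \<in> triangles E - D. f \<subseteq> T}" using T by simp
    then have "card {T \<in> triangles E - D. f \<subseteq> T} \<noteq> 0" using fT by auto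
    then show "1 \<le> card {T \<in> triangles E - D. f \<subseteq> T}" by linarith
  qed
  also have "\<dots> = (\<Sum>T\<in>triangles E - D. card {f \<in> Q. f \<subseteq> T})"
    by (rule sum_multicount_gen) (use fQ fT in auto)
  also have "\<dots> \<le> (\<Sum>T\<in>triangles E - D. 2)"
  proof (rule sum_mono)
    fix T assume T: "T \<in> triangles E - D"
    have sub: "{f \<in> Q. f \<subseteq> T} = Q \<inter> nsets T 2"
      using edge_nsets[OF V(2)] QE by blast
    have "T \<notin> triangles Q" using Qfree by blast
    then have "\<not> nsets T 2 \<subseteq> Q" using T by (auto simp: triangles_def)
    then have "Q \<inter> nsets T 2 \<subset> nsets T 2" by blast
    moreover have "card (nsets T 2) = 3" using T card_nsets_2_triangle by blast
    ultimately have "card (Q \<inter> nsets T 2) < 3"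
      using psubset_card_mono[of "nsets T 2" "Q \<inter> nsets T 2"] by (simp add: card_ge_0_finite)
    then show "card {f \<in> Q. f \<subseteq> T} \<le> 2" using sub by simp
  qed
  also have "\<dots> = 2 * (card (triangles E) - card D)"
    using DE fT fD by (simp add: card_Diff_subset)
  finally have "card Q \<le> 2 * (card (triangles E) - card D)" .
  moreover have "card D \<le> card (triangles E)" using DE fT card_mono by blast
  ultimately have ct: "real (card D) + real (card Q) / 2 \<le> real (card (triangles E))"
    by linarith

  have light: "real (codegree L f) \<le> \<epsilon> * n" if "f \<in> L" for f
  proof -
    have "f \<noteq> {}" using that LV by (auto simp: nsets_def)
    then have "codegree L f \<le> codegree E f" using codegree_mono[OF V LE] by blast
    moreover have "real (codegree E f) \<le> \<epsilon> * n" using that by (auto simp: L_def)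
    ultimately show ?thesis by linarith
  qed
  define w where "w f = (\<Sum>v\<in>f. real (degree_in L v))" for f
  have w_edge: "w f \<le> n + \<epsilon> * n" if "f \<in> L" for f
  proof -
    have "f \<in> nsets V 2" using that LV by blast
    then obtain x y where xy: "f = {x, y}" "x \<noteq> y" by (rule nsets2_E)
    have "(\<Sum>v\<in>f. degree_in L v) \<le> card V + codegree L f"
      using sum_degree_le[OF V(1) LV, of f] xy by simp
    then have "w f \<le> n + real (codegree L f)"
      unfolding w_def n(1) of_nat_sum[symmetric] of_nat_add[symmetric] of_nat_le_iff .
    then show ?thesis using light[OF that] by linarith
  qed
  \<comment> \<open>Each vertex of a triangle lies on two of its edges, hence the factor 2. The
    three codegrees are small because packed triangles consist of light edges.\<close>
  have w_tri: "(\<Sum>f\<in>nsets T 2. w f) \<le> 2 * (n + 3 * \<epsilon> * n)" if "T \<in> D" for T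
  proof -
    have T: "T \<in> triangles L" using that D by blast
    then have "finite T" "nsets T 2 \<subseteq> L" by (auto simp: triangles_def)
    then have "(\<Sum>v\<in>T. degree_in L v) \<le> card V + (\<Sum>f\<in>nsets T 2. codegree L f)"
      using sum_degree_le[OF V(1) LV] by blast
    then have "real (\<Sum>v\<in>T. degree_in L v) \<le> n + (\<Sum>f\<in>nsets T 2. real (codegree L f))"
      unfolding n(1) of_nat_sum[symmetric] of_nat_add[symmetric] of_nat_le_iff .
    also have "(\<Sum>f\<in>nsets T 2. real (codegree L f)) \<le> real (card (nsets T 2)) * (\<epsilon> * n)"
      using light \<open>nsets T 2 \<subseteq> L\<close> by (intro sum_bounded_above) auto
    finally have "(\<Sum>v\<in>T. real (degree_in L v)) \<le> n + 3 * \<epsilon> * n"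
      using card_nsets_2_triangle[OF T] by simp
    then show ?thesis
      unfolding w_def sum_nsets_2_triangle[OF T] by simp
  qed
  have "sum w L = sum w Q + sum w P"
    unfolding Q_def using PL fL sum.subset_diff by blast
  also have "sum w P = (\<Sum>T\<in>D. \<Sum>f\<in>nsets T 2. w f)"
    unfolding P_def using fD fin2 disj
    by (intro sum.UNION_disjoint) (auto simp: disjoint_family_on_def)
  also have "\<dots> \<le> real (card D) * (2 * (n + 3 * \<epsilon> * n))"
    using w_tri by (rule sum_bounded_above)
  also have "sum w Q \<le> real (card Q) * (n + \<epsilon> * n)"
    using w_edge by (intro sum_bounded_above) (auto simp: Q_def)
  finally have "sum w L \<le> real (card Q) * (n + \<epsilon> * n) + 2 * real (card D) * (n + 3 * \<epsilon> * n)"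
    by (simp add: algebra_simps)
  then have "n * sum w L \<le> n * (real (card Q) * (n + \<epsilon> * n) + 2 * real (card D) * (n + 3 * \<epsilon> * n))"
    using n(1) by (intro mult_left_mono) auto
  moreover have "4 * (real (card L))\<^sup>2 \<le> n * sum w L"
    unfolding w_def n(1) by (rule sum_edges_degree_ge[OF V(1) LV])
  ultimately show ?thesis
    using that[OF QE Qfree cE ct] unfolding cL by linarith
qed

section \<open>Optimising the edge and triangle densities\<close>

lemma packing_arith:
  fixes d q e t \<epsilon> :: real
  defines "s \<equiv> 3 * d + q"
  assumes "d \<ge> 0" "q \<ge> 0" "0 < \<epsilon>" "\<epsilon> \<le> 1 / 2"
    and deg: "4 * s\<^sup>2 \<le> q * (1 + \<epsilon>) + 2 * d * (1 + 3 * \<epsilon>)"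
    and e: "e \<le> \<epsilon> + s" and t: "d + q / 2 \<le> t"
  shows "e - t \<le> 1 / 8 + 3 / 2 * \<epsilon> - 2 * (s - 1 / 4)\<^sup>2" "d \<le> s - 4 * s\<^sup>2 + \<epsilon>"
proof -
  have "d * \<epsilon> \<ge> 0" "q * \<epsilon> \<ge> 0" "s \<ge> 0" using assms by auto
  \<comment> \<open>A crude form of the degree bound. It yields \<open>s \<le> 1 / 2\<close>, which
    later turns the error term \<open>2 * (s * \<epsilon>)\<close> into
    \<open>\<epsilon>\<close>.\<close>
  then have "q * (1 + \<epsilon>) + 2 * d * (1 + 3 * \<epsilon>) \<le> s * (1 + 2 * \<epsilon>)"
    using assms(2) by (simp add: s_def algebra_simps)
  also have "\<dots> \<le> s * 2" using assms(5) \<open>s \<ge> 0\<close> by (intro mult_left_mono) auto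
  finally have "s * (4 * s) \<le> s * 2" using deg by (simp add: power2_eq_square)
  then have "s \<le> 1 / 2"
    using \<open>s \<ge> 0\<close> by (cases "s = 0") (auto simp: mult_le_cancel_left)
  have "q * (1 + \<epsilon>) + 2 * d * (1 + 3 * \<epsilon>) \<le> (s - d) + 2 * (s * \<epsilon>)"
    using \<open>q * \<epsilon> \<ge> 0\<close> by (simp add: s_def algebra_simps)
  also have "s * \<epsilon> \<le> (1 / 2) * \<epsilon>" using \<open>s \<le> 1 / 2\<close> assms(4) by (intro mult_right_mono) auto
  finally show d: "d \<le> s - 4 * s\<^sup>2 + \<epsilon>" using deg by simp
  \<comment> \<open>Eliminating \<open>q = s - 3 * d\<close> leaves \<open>d / 2\<close> with a
    positive sign; the bound on \<open>d\<close> just proved replaces it, and completing the square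
    finishes.\<close>
  have "e - t \<le> \<epsilon> + s - d - q / 2" using e t by simp
  also have "\<dots> = \<epsilon> + s / 2 + d / 2" by (simp add: s_def field_simps)
  also have "\<dots> \<le> \<epsilon> + s / 2 + (s - 4 * s\<^sup>2 + \<epsilon>) / 2" using d by simp
  also have "\<dots> = 1 / 8 + 3 / 2 * \<epsilon> - 2 * (s - 1 / 4)\<^sup>2"
    by (simp add: power2_eq_square field_simps)
  finally show "e - t \<le> 1 / 8 + 3 / 2 * \<epsilon> - 2 * (s - 1 / 4)\<^sup>2" .
qed

text \<open>A deficit of order \<open>\<delta>^2\<close> in the optimum forces the deviation of
  \<open>s\<close> from \<open>1/4\<close> to be of order \<open>\<delta>\<close>. Since
  \<open>s - 4 * s^2\<close> vanishes at \<open>1/4\<close>, also \<open>d\<close> is of order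
  \<open>\<delta>\<close>, so nearly all of \<open>s\<close> comes from \<open>q\<close>. The
  constant 9 is generous.\<close>

lemma packing_stability_arith:
  fixes d q e t \<delta> :: real
  defines "s \<equiv> 3 * d + q"
  assumes \<delta>: "0 < \<delta>" "\<delta> \<le> 1 / 10"
    and e: "e \<le> \<delta>\<^sup>2 + s"
    and up: "e - t \<le> 1 / 8 + 3 / 2 * \<delta>\<^sup>2 - 2 * (s - 1 / 4)\<^sup>2" and d: "d \<le> s - 4 * s\<^sup>2 + \<delta>\<^sup>2"
    and low: "1 / 8 - 2 * \<delta>\<^sup>2 \<le> e - t"
  shows "q \<ge> 1 / 4 - 9 * \<delta>" "e \<le> 1 / 4 + 9 * \<delta>" "t \<le> 1 / 8 + 9 * \<delta>"
proof -
  have "(3 / 2 * \<delta>)\<^sup>2 = 9 / 4 * \<delta>\<^sup>2" by (simp add: power2_eq_square)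
  then have "(s - 1 / 4)\<^sup>2 \<le> (3 / 2 * \<delta>)\<^sup>2"
    using up low zero_le_power2[of \<delta>] by linarith
  then have \<sigma>: "\<bar>s - 1 / 4\<bar> \<le> 3 / 2 * \<delta>"
    using \<delta>(1) abs_le_square_iff[of "s - 1 / 4" "3 / 2 * \<delta>"] by simp
  have "\<delta>\<^sup>2 \<le> (1 / 10) * \<delta>" using \<delta> by (simp add: power2_eq_square)
  moreover have "s - 4 * s\<^sup>2 = - (s - 1 / 4) - 4 * (s - 1 / 4)\<^sup>2"
    by (simp add: power2_eq_square field_simps)
  then have "s - 4 * s\<^sup>2 \<le> \<bar>s - 1 / 4\<bar>"
    using zero_le_power2[of "s - 1 / 4"] by linarith
  ultimately show "q \<ge> 1 / 4 - 9 * \<delta>" "e \<le> 1 / 4 + 9 * \<delta>" "t \<le> 1 / 8 + 9 * \<delta>"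
    using \<sigma> e d low \<delta>(1) unfolding s_def by linarith+
qed

text \<open>\<open>triangle_free_part\<close> divided by \<open>n^2\<close> and fed into
  \<open>packing_arith\<close>; here \<open>d\<close> is the packing size relative to
  \<open>n^2\<close>.\<close>

lemma edges_minus_triangles:
  fixes n \<epsilon> :: real
  assumes V: "finite V" "E \<subseteq> nsets V 2" and \<epsilon>: "\<epsilon> > 0" "\<epsilon> \<le> 1 / 2"
    and cov: "\<forall>f\<in>E. \<exists>T\<in>triangles E. f \<subseteq> T"
    and n: "n = real (card V)" "3 \<le> 2 * \<epsilon>\<^sup>2 * n"
    and t: "2 * real (card (triangles E)) \<le> n\<^sup>2"
  obtains Q d where "Q \<subseteq> E" "triangles Q = {}"
    "card E / n\<^sup>2 \<le> \<epsilon> + (3 * d + card Q / n\<^sup>2)"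
    "card E / n\<^sup>2 - card (triangles E) / n\<^sup>2
      \<le> 1 / 8 + 3 / 2 * \<epsilon> - 2 * ((3 * d + card Q / n\<^sup>2) - 1 / 4)\<^sup>2"
    "d \<le> (3 * d + card Q / n\<^sup>2) - 4 * (3 * d + card Q / n\<^sup>2)\<^sup>2 + \<epsilon>"
proof -
  obtain Q d where Q: "Q \<subseteq> E" "triangles Q = {}"
    "real (card E) \<le> \<epsilon> * n\<^sup>2 + 3 * real d + real (card Q)"
    "real d + real (card Q) / 2 \<le> real (card (triangles E))"
    "4 * (3 * real d + real (card Q))\<^sup>2
       \<le> n * (real (card Q) * (n + \<epsilon> * n) + 2 * real d * (n + 3 * \<epsilon> * n))"
    using triangle_free_part[OF V \<epsilon>(1) cov n t] .
  have "n > 0" using n by (cases "card V = 0") auto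
  define q' d' where "q' = card Q / n\<^sup>2" and "d' = d / n\<^sup>2"
  have pos: "d' \<ge> 0" "q' \<ge> 0" by (simp_all add: q'_def d'_def)
  have [simp]: "real (card Q) = q' * n\<^sup>2" "real d = d' * n\<^sup>2"
    using \<open>n > 0\<close> by (simp_all add: q'_def d'_def)
  have e: "card E / n\<^sup>2 \<le> \<epsilon> + (3 * d' + q')"
    using Q(3) \<open>n > 0\<close> by (simp add: divide_le_eq algebra_simps)
  have t': "d' + q' / 2 \<le> card (triangles E) / n\<^sup>2"
    using Q(4) \<open>n > 0\<close> by (simp add: le_divide_eq algebra_simps)
  have "(n\<^sup>2)\<^sup>2 * (4 * (3 * d' + q')\<^sup>2) \<le> (n\<^sup>2)\<^sup>2 * (q' * (1 + \<epsilon>) + 2 * d' * (1 + 3 * \<epsilon>))"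
    using Q(5) by (simp add: power2_eq_square algebra_simps)
  then have deg: "4 * (3 * d' + q')\<^sup>2 \<le> q' * (1 + \<epsilon>) + 2 * d' * (1 + 3 * \<epsilon>)"
    by (rule mult_left_le_imp_le) (use \<open>n > 0\<close> in simp)
  show ?thesis
    by (rule that[OF Q(1,2), of d', folded q'_def, OF e packing_arith[OF pos \<epsilon> deg e t']])
qed

lemma edges_minus_triangles_le:
  fixes n \<epsilon> :: real
  assumes V: "finite V" "E \<subseteq> nsets V 2" and \<epsilon>: "\<epsilon> > 0" "\<epsilon> \<le> 1 / 2"
    and cov: "\<forall>f\<in>E. \<exists>T\<in>triangles E. f \<subseteq> T"
    and n: "n = real (card V)" "3 \<le> 2 * \<epsilon>\<^sup>2 * n"
    and t: "2 * real (card (triangles E)) \<le> n\<^sup>2"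
  shows "real (card E) - real (card (triangles E)) \<le> (1 / 8 + 3 / 2 * \<epsilon>) * n\<^sup>2"
proof -
  obtain Q d where "Q \<subseteq> E" "triangles Q = {}"
    "card E / n\<^sup>2 \<le> \<epsilon> + (3 * d + card Q / n\<^sup>2)"
    "card E / n\<^sup>2 - card (triangles E) / n\<^sup>2
      \<le> 1 / 8 + 3 / 2 * \<epsilon> - 2 * ((3 * d + card Q / n\<^sup>2) - 1 / 4)\<^sup>2"
    "d \<le> (3 * d + card Q / n\<^sup>2) - 4 * (3 * d + card Q / n\<^sup>2)\<^sup>2 + \<epsilon>"
    using edges_minus_triangles[OF V \<epsilon> cov n t] .
  then have "card E / n\<^sup>2 - card (triangles E) / n\<^sup>2 \<le> 1 / 8 + 3 / 2 * \<epsilon>"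
    using zero_le_power2[of "(3 * d + card Q / n\<^sup>2) - 1 / 4"] by linarith
  moreover have "n > 0" using n by (cases "card V = 0") auto
  ultimately show ?thesis
    by (simp add: diff_divide_distrib[symmetric] divide_le_eq)
qed

text \<open>Light edges are taken with threshold parameter \<open>\<delta>^2\<close>, so that the
  square root lost in \<open>packing_stability_arith\<close> leaves errors of order
  \<open>\<delta>\<close>.\<close>

lemma large_triangle_free_subgraph:
  fixes n \<delta> :: real
  assumes V: "finite V" "E \<subseteq> nsets V 2" and \<delta>: "\<delta> > 0" "\<delta> \<le> 1 / 10"
    and cov: "\<forall>f\<in>E. \<exists>T\<in>triangles E. f \<subseteq> T"
    and n: "n = real (card V)" "3 \<le> 2 * (\<delta>\<^sup>2)\<^sup>2 * n"
    and t: "2 * real (card (triangles E)) \<le> n\<^sup>2"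
    and low: "(1 / 8 - 2 * \<delta>\<^sup>2) * n\<^sup>2 \<le> real (card E) - real (card (triangles E))"
  obtains Q where "Q \<subseteq> E" "triangles Q = {}" "(1 / 4 - 9 * \<delta>) * n\<^sup>2 \<le> real (card Q)"
    "real (card E) \<le> (1 / 4 + 9 * \<delta>) * n\<^sup>2" "real (card (triangles E)) \<le> (1 / 8 + 9 * \<delta>) * n\<^sup>2"
proof -
  have "\<delta>\<^sup>2 \<le> (1 / 10)\<^sup>2" using \<delta> by (intro power_mono) auto
  then have \<epsilon>: "\<delta>\<^sup>2 > 0" "\<delta>\<^sup>2 \<le> 1 / 2" using \<delta> by (auto simp: power2_eq_square)
  obtain Q d where Q: "Q \<subseteq> E" "triangles Q = {}"
    "card E / n\<^sup>2 \<le> \<delta>\<^sup>2 + (3 * d + card Q / n\<^sup>2)"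
    "card E / n\<^sup>2 - card (triangles E) / n\<^sup>2
      \<le> 1 / 8 + 3 / 2 * \<delta>\<^sup>2 - 2 * ((3 * d + card Q / n\<^sup>2) - 1 / 4)\<^sup>2"
    "d \<le> (3 * d + card Q / n\<^sup>2) - 4 * (3 * d + card Q / n\<^sup>2)\<^sup>2 + \<delta>\<^sup>2"
    using edges_minus_triangles[OF V \<epsilon> cov n t] .
  have "n > 0" using n by (cases "card V = 0") auto
  then have low': "1 / 8 - 2 * \<delta>\<^sup>2 \<le> card E / n\<^sup>2 - card (triangles E) / n\<^sup>2"
    using low by (simp add: diff_divide_distrib[symmetric] le_divide_eq)
  from packing_stability_arith[OF \<delta> Q(3-5) low'] show ?thesis
    using that[OF Q(1,2)] \<open>n > 0\<close> by (simp add: le_divide_eq divide_le_eq)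
qed

text \<open>In a triangle-free graph the two neighbourhoods of an edge are disjoint and independent, so an
  edge with maximal degree sum yields an almost spanning bipartition.\<close>

lemma triangle_free_bipartition:
  fixes n \<kappa> :: real
  assumes V: "finite V" "Q \<subseteq> nsets V 2" and free: "triangles Q = {}"
    and n: "n = real (card V)" "n > 0"
    and q: "(1 / 4 - \<kappa>) * n\<^sup>2 \<le> real (card Q)" "\<kappa> < 1 / 4"
  obtains X Y where "X \<union> Y = V" "X \<inter> Y = {}"
    "(1 / 4 - 5 * \<kappa>) * n\<^sup>2 \<le> real (card {(x, y) \<in> X \<times> Y. {x, y} \<in> Q})"
proof -
  have fQ: "finite Q" using finite_edges[OF V] .
  have "0 < (1 / 4 - \<kappa>) * n\<^sup>2" using n q(2) by simp
  then have "real (card Q) > 0" using q(1) by linarith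
  then have Qne: "Q \<noteq> {}" by auto
  define N where "N v = {u. {u, v} \<in> Q}" for v
  have NV: "N v \<subseteq> V" for v using edge_ends[OF V(2)] by (auto simp: N_def)
  have fN: "finite (N v)" for v using NV V(1) finite_subset by blast
  have deg: "degree_in Q v = card (N v)" for v by (simp add: degree_in_def N_def)
  define w where "w f = (\<Sum>v\<in>f. real (degree_in Q v))" for f
  \<comment> \<open>By averaging, some edge has at least the mean degree sum provided by
    Cauchy-Schwarz.\<close>
  have "\<exists>f\<in>Q. 4 * real (card Q) \<le> n * w f"
  proof (rule ccontr)
    assume "\<not> ?thesis"
    then have "sum (\<lambda>f. n * w f) Q < sum (\<lambda>f. 4 * real (card Q)) Q"
      using Qne fQ by (intro sum_strict_mono) auto
    then have "n * sum w Q < 4 * (real (card Q))\<^sup>2"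
      by (simp add: sum_distrib_left power2_eq_square)
    then show False using sum_edges_degree_ge[OF V] unfolding w_def n(1) by linarith
  qed
  then obtain f where f: "f \<in> Q" "4 * real (card Q) \<le> n * w f" ..
  have "f \<in> nsets V 2" using f V by blast
  then obtain x y where xy: "f = {x, y}" "x \<noteq> y" by (rule nsets2_E)
  have no_tri: False if "{a, b} \<in> Q" "{a, c} \<in> Q" "{b, c} \<in> Q" for a b c
  proof -
    have "a \<noteq> b" "a \<noteq> c" "b \<noteq> c"
      using edge_ends[OF V(2) that(1)] edge_ends[OF V(2) that(2)] edge_ends[OF V(2) that(3)] by auto
    then have "{a, b, c} \<in> triangles Q" using that triangles_iff by metis
    then show False using free by simp
  qed
  have disj: "N x \<inter> N y = {}"
  proof (rule equals0I)
    fix u assume "u \<in> N x \<inter> N y"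
    then show False using no_tri[of u x y] f(1) xy by (simp add: N_def)
  qed
  have indep: "{a, b} \<notin> Q" if "a \<in> N v" "b \<in> N v" for a b v
    using no_tri[of a b v] that by (auto simp: N_def)
  \<comment> \<open>The vertices adjacent to neither end of the chosen edge. The degree sum of that
    edge is nearly \<open>n\<close>, so there are at most \<open>4 * \<kappa> * n\<close> of
    them.\<close>
  define W where "W = V - (N x \<union> N y)"
  have "card (N x \<union> N y) = card (N x) + card (N y)"
    using card_Un_disjoint[OF fN fN disj] .
  moreover have "card (N x \<union> N y) \<le> card V" using NV V(1) by (intro card_mono) auto
  moreover have "card W = card V - card (N x \<union> N y)"
    unfolding W_def using NV fN by (intro card_Diff_subset) auto
  ultimately have cW: "real (card W) = n - w f"
    unfolding w_def n(1) xy(1) using xy(2) by (simp add: deg)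
  have "n * real (card W) \<le> n\<^sup>2 - 4 * real (card Q)"
    unfolding cW using f(2) by (simp add: right_diff_distrib power2_eq_square)
  also have "\<dots> \<le> n\<^sup>2 - 4 * ((1 / 4 - \<kappa>) * n\<^sup>2)" using q(1) by simp
  finally have W_small: "n * real (card W) \<le> 4 * \<kappa> * n\<^sup>2" by (simp add: algebra_simps)
  let ?X = "N x" and ?Y = "V - N x"
  let ?C = "{(a, b) \<in> ?X \<times> ?Y. {a, b} \<in> Q}"
  have fW: "finite W" and fC: "finite ?C"
    using V(1) fN[of x] finite_subset[of ?C "?X \<times> ?Y"] by (auto simp: W_def)
  \<comment> \<open>\<open>N x\<close> and \<open>N y\<close> are independent, so an edge avoiding
    \<open>W\<close> joins them. Assigning \<open>W\<close> to the second side loses at most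
    \<open>n\<close> edges per vertex of \<open>W\<close>, which raises the error from
    \<open>\<kappa>\<close> to \<open>5 * \<kappa>\<close>.\<close>
  have sub: "Q \<subseteq> (\<lambda>(a, b). {a, b}) ` ?C \<union> (\<Union>v\<in>W. {f \<in> Q. v \<in> f})"
  proof
    fix g assume g: "g \<in> Q"
    then have "g \<in> nsets V 2" using V by blast
    then obtain a b where ab: "g = {a, b}" "a \<in> V" "b \<in> V" by (rule nsets2_E)
    have ab': "{a, b} \<in> Q" "{b, a} \<in> Q" using g ab(1) by (auto simp: insert_commute)
    show "g \<in> (\<lambda>(a, b). {a, b}) ` ?C \<union> (\<Union>v\<in>W. {f \<in> Q. v \<in> f})"
    proof (cases "a \<in> W \<or> b \<in> W")
      case True
      then show ?thesis using g ab(1) by auto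
    next
      case False
      then have "a \<in> N x \<and> b \<notin> N x \<or> b \<in> N x \<and> a \<notin> N x"
        using indep[of a x b] indep[of a y b] ab' ab(2,3) by (auto simp: W_def)
      then have "(a, b) \<in> ?C \<or> (b, a) \<in> ?C" using ab' ab by auto
      moreover have "g = {b, a}" using ab(1) by auto
      ultimately show ?thesis using ab(1) by (metis (mono_tags, lifting) UnI1 case_prod_conv image_eqI)
    qed
  qed
  have "card Q \<le> card ((\<lambda>(a, b). {a, b}) ` ?C) + card (\<Union>v\<in>W. {f \<in> Q. v \<in> f})"
    using fC fW fQ by (intro order.trans[OF card_mono[OF _ sub] card_Un_le]) auto
  also have "card ((\<lambda>(a, b). {a, b}) ` ?C) \<le> card ?C" using fC by (rule card_image_le)
  also have "card (\<Union>v\<in>W. {f \<in> Q. v \<in> f}) \<le> (\<Sum>v\<in>W. card {f \<in> Q. v \<in> f})"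
    using fW by (rule card_UN_le)
  also have "\<dots> \<le> (\<Sum>v\<in>W. card V)"
    unfolding card_incident[OF V(2)] deg using NV V(1) by (intro sum_mono card_mono)
  finally have "card Q \<le> card ?C + card W * card V" by simp
  then have "real (card Q) \<le> real (card ?C + card W * card V)"
    unfolding of_nat_le_iff .
  then have "real (card Q) \<le> real (card ?C) + n * real (card W)"
    by (simp add: n(1) mult.commute)
  then have "(1 / 4 - 5 * \<kappa>) * n\<^sup>2 \<le> real (card ?C)"
    using q(1) W_small by (simp add: algebra_simps)
  then show ?thesis using that[of ?X ?Y] NV by blast
qed

section \<open>Stability\<close>

text \<open>For an edge the codegree counts the triangles through it, so a good pair has a unique
  completing vertex. Almost all cross pairs will be of this kind.\<close>

definition good_pair :: "'a set set \<Rightarrow> 'a \<Rightarrow> 'a \<Rightarrow> bool" where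
  "good_pair E x y \<longleftrightarrow> {x, y} \<in> E \<and> codegree E {x, y} = 1"

lemma good_pair_commute: "good_pair E x y \<longleftrightarrow> good_pair E y x"
  by (simp add: good_pair_def insert_commute)

lemma good_pair_unique:
  assumes "good_pair E x y" "{u, x} \<in> E" "{u, y} \<in> E" "{v, x} \<in> E" "{v, y} \<in> E"
  shows "u = v"
proof -
  have "card {u. \<forall>v\<in>{x, y}. {u, v} \<in> E} = 1"
    using assms(1) unfolding good_pair_def codegree_def by (rule conjunct2)
  then obtain w where "{u. \<forall>v\<in>{x, y}. {u, v} \<in> E} = {w}"
    by (rule card_1_singletonE)
  moreover have "u \<in> {u. \<forall>v\<in>{x, y}. {u, v} \<in> E}" "v \<in> {u. \<forall>v\<in>{x, y}. {u, v} \<in> E}"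
    using assms by simp_all
  ultimately show ?thesis by (metis singletonD)
qed

lemma good_pair_apex:
  assumes "good_pair E x y"
  obtains z where "{z, x} \<in> E" "{z, y} \<in> E"
proof -
  have "card {u. \<forall>v\<in>{x, y}. {u, v} \<in> E} = 1"
    using assms unfolding good_pair_def codegree_def by (rule conjunct2)
  then obtain w where "{u. \<forall>v\<in>{x, y}. {u, v} \<in> E} = {w}"
    by (rule card_1_singletonE)
  then have "w \<in> {u. \<forall>v\<in>{x, y}. {u, v} \<in> E}" by simp
  then show ?thesis using that[of w] by simp
qed

text \<open>\<open>excess\<close> counts triangles on cross edges beyond the first one each,
  \<open>bad\<close> counts cross pairs that are not good. Both bounds use \<open>\<gamma>^2\<close>
  so that Markov's inequality leaves \<open>\<gamma> * n\<close> both as the threshold for a vertex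
  and as the number of exceptional vertices.\<close>

locale near_bipartite =
  fixes V :: "'a set" and E :: "'a set set" and X Y :: "'a set" and n \<gamma> :: real
  assumes V: "finite V" "E \<subseteq> nsets V 2"
    and XY: "X \<union> Y = V" "X \<inter> Y = {}"
    and n: "n = real (card V)" "n > 0"
    and \<gamma>: "0 < \<gamma>" "\<gamma> \<le> 1 / 100"
    and large: "n / 4 \<le> real (card X)" "n / 4 \<le> real (card Y)"
    and excess: "real (\<Sum>y\<in>Y. \<Sum>x\<in>X. if {x, y} \<in> E then codegree E {x, y} - 1 else 0) \<le> \<gamma>\<^sup>2 * n\<^sup>2"
    and bad: "real (\<Sum>y\<in>Y. card {x \<in> X. \<not> good_pair E x y}) \<le> \<gamma>\<^sup>2 * n\<^sup>2"
begin

lemma finite_X: "finite X" and finite_Y: "finite Y"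
  using V(1) XY(1) by (metis finite_Un)+

text \<open>All assumptions are symmetric in the two sides, so the statements below about
  \<open>Y\<close> transfer to \<open>X\<close>.\<close>

lemma swap_sides: "near_bipartite V E Y X n \<gamma>"
proof
  show "real (\<Sum>y\<in>X. \<Sum>x\<in>Y. if {x, y} \<in> E then codegree E {x, y} - 1 else 0) \<le> \<gamma>\<^sup>2 * n\<^sup>2"
    using excess by (subst sum.swap) (simp only: insert_commute)
  have "(\<Sum>y\<in>X. card {x \<in> Y. \<not> good_pair E x y}) = (\<Sum>x\<in>Y. card {y \<in> X. \<not> good_pair E x y})"
    using finite_X finite_Y by (intro sum_multicount_gen) auto
  also have "\<dots> = (\<Sum>y\<in>Y. card {x \<in> X. \<not> good_pair E x y})"
    by (simp only: good_pair_commute)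
  finally show "real (\<Sum>y\<in>X. card {x \<in> Y. \<not> good_pair E x y}) \<le> \<gamma>\<^sup>2 * n\<^sup>2"
    using bad by simp
qed (use V XY n \<gamma> large in auto)

definition typical :: "'a set" where
  "typical = {y \<in> Y. real (card {x \<in> X. \<not> good_pair E x y}) \<le> \<gamma> * n}"

definition typical_edges :: "'a set set" where
  "typical_edges = {f \<in> E. f \<subseteq> typical}"

lemma typical_sub: "typical \<subseteq> Y" by (auto simp: typical_def)

text \<open>Markov's inequality: an atypical vertex contributes at least \<open>\<gamma> * n\<close>
  to a total of at most \<open>(\<gamma> * n)^2\<close>.\<close>

lemma card_atypical: "real (card (Y - typical)) \<le> \<gamma> * n"
proof -
  have "real (card (Y - typical)) * (\<gamma> * n) \<le> (\<Sum>y\<in>Y - typical. real (card {x \<in> X. \<not> good_pair E x y}))"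
    by (rule sum_bounded_below) (auto simp: typical_def)
  also have "\<dots> \<le> (\<Sum>y\<in>Y. real (card {x \<in> X. \<not> good_pair E x y}))"
    using finite_Y by (intro sum_mono2) auto
  also have "\<dots> \<le> (\<gamma> * n) * (\<gamma> * n)"
    using bad by (simp add: power2_eq_square mult_ac)
  finally show ?thesis
    by (rule mult_right_le_imp_le) (use \<gamma> n in simp)
qed

text \<open>Three typical vertices exclude at most \<open>3 * \<gamma> * n < card X\<close>
  vertices, so some \<open>x\<close> in \<open>X\<close> forms a good pair with all three. Then
  \<open>b\<close> and \<open>c\<close> both complete the good pair of \<open>x\<close> and
  \<open>a\<close> to a triangle and must coincide. Hence the typical edges form a matching.\<close>

lemma typical_nbr_unique:
  assumes "a \<in> typical" "b \<in> typical" "c \<in> typical" "{b, a} \<in> E" "{c, a} \<in> E"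
  shows "b = c"
proof -
  let ?B = "\<lambda>y. {x \<in> X. \<not> good_pair E x y}"
  have B: "real (card (?B y)) \<le> \<gamma> * n" if "y \<in> typical" for y using that by (simp add: typical_def)
  have "card (?B a \<union> ?B b \<union> ?B c) \<le> card (?B a) + card (?B b) + card (?B c)"
    by (rule order.trans[OF card_Un_le add_right_mono[OF card_Un_le]])
  then have "real (card (?B a \<union> ?B b \<union> ?B c)) \<le> real (card (?B a) + card (?B b) + card (?B c))"
    unfolding of_nat_le_iff .
  then have "real (card (?B a \<union> ?B b \<union> ?B c)) \<le> 3 * (\<gamma> * n)"
    using B[OF assms(1)] B[OF assms(2)] B[OF assms(3)] by simp
  also have "\<gamma> * n \<le> (1 / 100) * n" using \<gamma> n by (intro mult_right_mono) auto
  then have "3 * (\<gamma> * n) < real (card X)" using large n by linarith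
  finally have "card (?B a \<union> ?B b \<union> ?B c) < card X" by simp
  then have "\<not> X \<subseteq> ?B a \<union> ?B b \<union> ?B c"
    using finite_X card_mono[of "?B a \<union> ?B b \<union> ?B c" X] by auto
  then obtain x where x: "good_pair E x a" "good_pair E x b" "good_pair E x c" by blast
  show ?thesis
    using good_pair_unique[OF x(1), of b c] x assms(4,5)
    by (simp add: good_pair_def insert_commute)
qed

lemma typical_edges_sub: "typical_edges \<subseteq> E" by (auto simp: typical_edges_def)

lemma typical_edges_Y: "\<Union> typical_edges \<subseteq> Y" using typical_sub by (auto simp: typical_edges_def)

lemma typical_edgesE:
  assumes "f \<in> typical_edges" "a \<in> f"
  obtains b where "f = {b, a}" "a \<in> typical" "b \<in> typical" "{b, a} \<in> E" "a \<noteq> b"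
proof -
  have "f \<in> nsets V 2" "f \<subseteq> typical" "f \<in> E" using assms(1) V(2) by (auto simp: typical_edges_def)
  then obtain x y where f: "f = {x, y}" "x \<noteq> y" by (auto elim: nsets2_E)
  define b where "b = (if a = x then y else x)"
  have "f = {b, a}" "a \<noteq> b" using f assms(2) by (auto simp: b_def)
  then show ?thesis using that[of b] \<open>f \<subseteq> typical\<close> \<open>f \<in> E\<close> by simp
qed

lemma typical_edges_disjoint: "disjoint typical_edges"
proof (rule disjointI)
  fix f g assume fg: "f \<in> typical_edges" "g \<in> typical_edges" "f \<noteq> g"
  show "f \<inter> g = {}"
  proof (rule equals0I)
    fix a assume "a \<in> f \<inter> g"
    then have af: "a \<in> f" and ag: "a \<in> g" by auto
    obtain b where b: "f = {b, a}" "a \<in> typical" "b \<in> typical" "{b, a} \<in> E" "a \<noteq> b"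
      using typical_edgesE[OF fg(1) af] .
    obtain c where c: "g = {c, a}" "a \<in> typical" "c \<in> typical" "{c, a} \<in> E" "a \<noteq> c"
      using typical_edgesE[OF fg(2) ag] .
    have "b = c" using typical_nbr_unique[OF b(2,3) c(3) b(4) c(4)] .
    then show False using b(1) c(1) fg(3) by simp
  qed
qed

text \<open>Let \<open>p y\<close> be the partner of a matched vertex \<open>y\<close>. If
  \<open>y\<close> is good with \<open>x\<close> and \<open>x'\<close>, and \<open>p y\<close> is
  good with \<open>x\<close>, then \<open>x'\<close> and \<open>p y\<close> are two completions of
  the good pair \<open>y\<close>, \<open>x\<close>. So \<open>y\<close> is bad for \<open>x\<close>
  or for \<open>x'\<close>, or \<open>p y\<close> is bad for \<open>x\<close>; as \<open>p\<close>
  is injective, each case accounts for at most \<open>\<gamma> * n\<close> vertices.\<close>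

lemma typical_edges_cover_small:
  assumes x: "x \<in> X" "x' \<in> X" "{x', x} \<in> E"
    and typx: "real (card {y \<in> Y. \<not> good_pair E y x}) \<le> \<gamma> * n"
      "real (card {y \<in> Y. \<not> good_pair E y x'}) \<le> \<gamma> * n"
  shows "real (card (\<Union> typical_edges)) \<le> 3 * (\<gamma> * n)"
proof -
  have "\<exists>b. b \<in> \<Union> typical_edges \<and> {b, a} \<in> E \<and> {a, b} \<in> typical_edges" if a: "a \<in> \<Union> typical_edges" for a
  proof -
    obtain f where f: "f \<in> typical_edges" "a \<in> f" using a by blast
    obtain b where b: "f = {b, a}" "{b, a} \<in> E" using typical_edgesE[OF f] by metis
    then have "{a, b} \<in> typical_edges" using f(1) by (simp add: insert_commute)
    then show ?thesis using b by blast
  qed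
  then obtain p where p: "\<And>a. a \<in> \<Union> typical_edges \<Longrightarrow> p a \<in> \<Union> typical_edges \<and> {p a, a} \<in> E \<and> {a, p a} \<in> typical_edges"
    by metis
  have inj: "inj_on p (\<Union> typical_edges)"
  proof (rule inj_onI)
    fix a b assume ab: "a \<in> \<Union> typical_edges" "b \<in> \<Union> typical_edges" "p a = p b"
    have t: "a \<in> typical" "b \<in> typical" "p a \<in> typical"
      using ab(1,2) p[OF ab(1)] by (auto simp: typical_edges_def)
    show "a = b"
      using typical_nbr_unique[OF t(3) t(1) t(2)] p[OF ab(1)] p[OF ab(2)] ab(3) by (simp add: insert_commute)
  qed
  let ?B = "{y \<in> Y. \<not> good_pair E y x}" and ?B' = "{y \<in> Y. \<not> good_pair E y x'}"
  let ?P = "{y \<in> \<Union> typical_edges. p y \<in> ?B}"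
  have "\<Union> typical_edges \<subseteq> ?B \<union> ?B' \<union> ?P"
  proof
    fix y assume y: "y \<in> \<Union> typical_edges"
    then have yY: "y \<in> Y" "p y \<in> Y" using p[OF y] typical_edges_Y by auto
    have "x' \<noteq> p y" using yY x XY by auto
    then have "\<not> (good_pair E y x \<and> good_pair E y x' \<and> good_pair E (p y) x)"
      using good_pair_unique[of E y x x' "p y"] p[OF y] x(3)
      by (auto simp: good_pair_def insert_commute)
    then show "y \<in> ?B \<union> ?B' \<union> ?P" using y yY by auto
  qed
  moreover have fin: "finite ?B" "finite ?B'" "finite ?P"
    using finite_Y finite_subset[OF typical_edges_Y finite_Y] finite_subset[of ?P "\<Union> typical_edges"] by auto
  ultimately have "card (\<Union> typical_edges) \<le> card (?B \<union> ?B' \<union> ?P)"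
    by (intro card_mono) auto
  also have "\<dots> \<le> card ?B + card ?B' + card ?P"
    by (rule order.trans[OF card_Un_le add_right_mono[OF card_Un_le]])
  also have "card ?P \<le> card ?B"
    using fin(1) inj by (intro card_inj_on_le[of p]) (auto simp: inj_on_def)
  finally show ?thesis using typx by simp
qed

text \<open>The cross pairs whose triangle with third vertex in \<open>Y\<close> may fail to use an
  edge of \<open>typical_edges\<close>, because one of its vertices in \<open>Y\<close> is
  atypical.\<close>

definition uncovered :: "('a \<times> 'a) set" where
  "uncovered = {(x, y) \<in> X \<times> Y. y \<notin> typical \<or> {x, y} \<in> E \<and> (\<exists>z\<in>Y - typical. {z, x} \<in> E \<and> {z, y} \<in> E)}"

text \<open>Pairs with atypical \<open>y\<close> number at most \<open>card X\<close> times the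
  number of atypical vertices. For atypical \<open>z\<close> and a neighbour \<open>x\<close>, the
  possible \<open>y\<close> number \<open>codegree E {x, z}\<close>, which is at most one plus its
  excess; the ones give the same product again and the excesses sum to at most
  \<open>\<gamma>^2 * n^2\<close>.\<close>

lemma card_uncovered: "real (card uncovered) \<le> (2 * \<gamma> + \<gamma>\<^sup>2) * n\<^sup>2"
proof -
  let ?A = "Y - typical"
  let ?ex = "\<lambda>z x. if {x, z} \<in> E then codegree E {x, z} - 1 else 0"
  let ?S = "\<lambda>z x. if {x, z} \<in> E then {x} \<times> {y. {y, x} \<in> E \<and> {y, z} \<in> E} else {}"
  have fA: "finite ?A" using finite_Y by simp
  have S: "card (?S z x) \<le> 1 + ?ex z x" for z x
    by (auto simp: card_cartesian_product codegree_def)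
  have sub: "uncovered \<subseteq> X \<times> ?A \<union> (\<Union>z\<in>?A. \<Union>x\<in>X. ?S z x)"
    by (auto simp: uncovered_def insert_commute)
  have fS: "finite (?S z x)" for z x
    using finite_nbhd[OF V, of x] by simp
  have "finite (\<Union>z\<in>?A. \<Union>x\<in>X. ?S z x)"
    using fA finite_X fS by (intro finite_UN_I) auto
  then have "card uncovered \<le> card (X \<times> ?A) + card (\<Union>z\<in>?A. \<Union>x\<in>X. ?S z x)"
    using fA finite_X by (intro order.trans[OF card_mono[OF _ sub] card_Un_le]) simp
  also have "card (\<Union>z\<in>?A. \<Union>x\<in>X. ?S z x) \<le> (\<Sum>z\<in>?A. card (\<Union>x\<in>X. ?S z x))"
    using fA by (rule card_UN_le)
  also have "\<dots> \<le> (\<Sum>z\<in>?A. \<Sum>x\<in>X. card (?S z x))"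
    using finite_X by (intro sum_mono card_UN_le)
  also have "\<dots> \<le> (\<Sum>z\<in>?A. \<Sum>x\<in>X. 1 + ?ex z x)"
    by (intro sum_mono S)
  also have "\<dots> = card (X \<times> ?A) + (\<Sum>z\<in>?A. \<Sum>x\<in>X. ?ex z x)"
    by (simp add: sum_Suc card_cartesian_product sum.distrib)
  also have "(\<Sum>z\<in>?A. \<Sum>x\<in>X. ?ex z x) \<le> (\<Sum>z\<in>Y. \<Sum>x\<in>X. ?ex z x)"
    using finite_Y by (intro sum_mono2) auto
  finally have "card uncovered \<le> 2 * (card X * card ?A) + (\<Sum>z\<in>Y. \<Sum>x\<in>X. ?ex z x)"
    by (simp add: card_cartesian_product)
  then have "real (card uncovered) \<le> real (2 * (card X * card ?A) + (\<Sum>z\<in>Y. \<Sum>x\<in>X. ?ex z x))"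
    unfolding of_nat_le_iff .
  then have "real (card uncovered) \<le> 2 * (real (card X) * real (card ?A)) + \<gamma>\<^sup>2 * n\<^sup>2"
    using excess unfolding of_nat_add of_nat_mult by simp
  also have "real (card X) * real (card ?A) \<le> n * (\<gamma> * n)"
  proof (intro mult_mono card_atypical)
    show "real (card X) \<le> n" using V(1) XY(1) unfolding n(1) by (auto intro: card_mono)
  qed (use n in auto)
  finally show ?thesis by (simp add: power2_eq_square algebra_simps)
qed

lemma bad_pairs: "real (card {(x, y) \<in> X \<times> Y. \<not> good_pair E x y}) \<le> \<gamma>\<^sup>2 * n\<^sup>2"
proof -
  have "{(x, y) \<in> X \<times> Y. \<not> good_pair E x y} = prod.swap ` (SIGMA y:Y. {x \<in> X. \<not> good_pair E x y})"
    by auto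
  then have "card {(x, y) \<in> X \<times> Y. \<not> good_pair E x y} = card (SIGMA y:Y. {x \<in> X. \<not> good_pair E x y})"
    by (simp add: card_image)
  also have "\<dots> = (\<Sum>y\<in>Y. card {x \<in> X. \<not> good_pair E x y})"
    using finite_X finite_Y by (intro card_SigmaI) auto
  finally show ?thesis using bad by simp
qed

lemma uncovered_sub: "uncovered \<subseteq> X \<times> Y" by (auto simp: uncovered_def)

end

text \<open>Each good pair is completed to its triangle inside one of the two sides. Up to few exceptions
  the completing edge joins typical vertices, so it belongs to one of the two matchings.\<close>

lemma near_bipartite_matching:
  assumes "near_bipartite V E X Y n \<gamma>"
  obtains M where "M \<subseteq> E" "disjoint M"
    "\<Union> M \<subseteq> Y \<and> real (card (Y - \<Union> M)) \<le> 25 * \<gamma> * n \<or>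
     \<Union> M \<subseteq> X \<and> real (card (X - \<Union> M)) \<le> 25 * \<gamma> * n"
proof -
  \<comment> \<open>The matching \<open>a.typical_edges\<close> lies in \<open>Y\<close>, the
    matching \<open>b.typical_edges\<close> in \<open>X\<close>.\<close>
  interpret a: near_bipartite V E X Y n \<gamma> by fact
  interpret b: near_bipartite V E Y X n \<gamma> by (rule a.swap_sides)
  let ?P = "X - \<Union> b.typical_edges" and ?R = "Y - \<Union> a.typical_edges"
  let ?bad = "{(x, y) \<in> X \<times> Y. \<not> good_pair E x y}"
  \<comment> \<open>A good pair missed by both matchings still has a completing vertex
    \<open>z\<close> in one of the sides, and then \<open>z\<close> or the vertex on its side is
    atypical. So the product of the two unmatched sets is small.\<close>
  have sub: "?P \<times> ?R \<subseteq> ?bad \<union> a.uncovered \<union> prod.swap ` b.uncovered"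
  proof (rule subrelI)
    fix x y assume "(x, y) \<in> ?P \<times> ?R"
    then have xy: "x \<in> X" "y \<in> Y" "x \<notin> \<Union> b.typical_edges" "y \<notin> \<Union> a.typical_edges" by auto
    show "(x, y) \<in> ?bad \<union> a.uncovered \<union> prod.swap ` b.uncovered"
    proof (cases "good_pair E x y")
      case False
      then show ?thesis using xy by auto
    next
      case True
      then obtain z where z: "{z, x} \<in> E" "{z, y} \<in> E" by (rule good_pair_apex)
      have e: "{x, y} \<in> E" "{y, x} \<in> E" using True by (auto simp: good_pair_def insert_commute)
      have "z \<in> X \<or> z \<in> Y" using edge_ends[OF a.V(2) z(1)] a.XY by auto
      then show ?thesis
      proof
        assume "z \<in> Y"
        have "y \<notin> a.typical \<or> z \<notin> a.typical"
        proof (rule ccontr)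
          assume "\<not> ?thesis"
          then have "{z, y} \<in> a.typical_edges" using z by (simp add: a.typical_edges_def)
          then show False using xy(4) by auto
        qed
        then have "(x, y) \<in> a.uncovered" using xy z e \<open>z \<in> Y\<close> by (auto simp: a.uncovered_def)
        then show ?thesis by blast
      next
        assume "z \<in> X"
        have "x \<notin> b.typical \<or> z \<notin> b.typical"
        proof (rule ccontr)
          assume "\<not> ?thesis"
          then have "{z, x} \<in> b.typical_edges" using z by (simp add: b.typical_edges_def)
          then show False using xy(3) by auto
        qed
        then have "(y, x) \<in> b.uncovered" using xy z e \<open>z \<in> X\<close> by (auto simp: b.uncovered_def)
        then have "prod.swap (y, x) \<in> prod.swap ` b.uncovered" by (rule imageI)
        then show ?thesis by simp
      qed
    qed
  qed
  have fin: "finite (X \<times> Y)" "finite (Y \<times> X)" using a.finite_X a.finite_Y by auto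
  then have fin': "finite ?bad" "finite a.uncovered" "finite b.uncovered"
    using finite_subset[OF a.uncovered_sub fin(1)] finite_subset[OF b.uncovered_sub fin(2)]
    by (auto intro: finite_subset[OF _ fin(1)])
  have "card (?P \<times> ?R) \<le> card (?bad \<union> a.uncovered \<union> prod.swap ` b.uncovered)"
    using fin' by (intro card_mono[OF _ sub]) auto
  also have "\<dots> \<le> card ?bad + card a.uncovered + card (prod.swap ` b.uncovered)"
    by (rule order.trans[OF card_Un_le add_right_mono[OF card_Un_le]])
  also have "card (prod.swap ` b.uncovered) = card b.uncovered" by (simp add: card_image)
  finally have "card ?P * card ?R \<le> card ?bad + card a.uncovered + card b.uncovered"
    by (simp add: card_cartesian_product)
  then have "real (card ?P * card ?R) \<le> real (card ?bad + card a.uncovered + card b.uncovered)"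
    unfolding of_nat_le_iff .
  also have "\<dots> \<le> \<gamma>\<^sup>2 * n\<^sup>2 + (2 * \<gamma> + \<gamma>\<^sup>2) * n\<^sup>2 + (2 * \<gamma> + \<gamma>\<^sup>2) * n\<^sup>2"
    unfolding of_nat_add by (intro add_mono a.bad_pairs a.card_uncovered b.card_uncovered)
  also have "\<dots> = (4 * \<gamma> + 3 * \<gamma>\<^sup>2) * n\<^sup>2" by (simp add: algebra_simps)
  also have "\<gamma>\<^sup>2 \<le> \<gamma> * (1 / 100)"
    unfolding power2_eq_square using a.\<gamma> by (intro mult_left_mono) auto
  then have "(4 * \<gamma> + 3 * \<gamma>\<^sup>2) * n\<^sup>2 \<le> (5 * \<gamma>) * n\<^sup>2"
    using a.\<gamma> by (intro mult_right_mono) auto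
  finally have prod: "real (card ?P) * real (card ?R) \<le> 5 * \<gamma> * n\<^sup>2" by simp
  have \<gamma>n: "\<gamma> * n \<le> (1 / 100) * n" using a.\<gamma> a.n by (intro mult_right_mono) auto
  \<comment> \<open>Once one unmatched set has at least \<open>n / 5\<close> elements, the bound on
    the product makes the other one small.\<close>
  have cancel: "c \<le> 25 * \<gamma> * n" if "n / 5 \<le> b" "b * c \<le> 5 * \<gamma> * n\<^sup>2" "0 \<le> c" for b c :: real
  proof -
    have "(n / 5) * c \<le> b * c" using that by (intro mult_right_mono) auto
    also have "\<dots> \<le> (n / 5) * (25 * \<gamma> * n)" using that(2) by (simp add: power2_eq_square)
    finally show ?thesis by (rule mult_left_le_imp_le) (use a.n in simp)
  qed
  have cover: "real (card (\<Union> a.typical_edges)) \<le> 3 * (\<gamma> * n)" if ne: "b.typical_edges \<noteq> {}"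
  proof -
    obtain f where f: "f \<in> b.typical_edges" using ne by blast
    then have "f \<in> nsets V 2" using b.typical_edges_sub a.V(2) by blast
    then obtain x where "x \<in> f" by (auto elim: nsets2_E)
    obtain x' where x: "x \<in> b.typical" "x' \<in> b.typical" "{x', x} \<in> E"
      using b.typical_edgesE[OF f \<open>x \<in> f\<close>] by metis
    then show ?thesis using a.typical_edges_cover_small[of x x'] by (auto simp: b.typical_def)
  qed
  \<comment> \<open>If the matching in \<open>X\<close> is empty, all of \<open>X\<close> is
    unmatched and the matching in \<open>Y\<close> nearly covers \<open>Y\<close>. Otherwise one of
    its edges makes the matching in \<open>Y\<close> small by \<open>cover\<close>, and the roles
    are exchanged.\<close>
  show ?thesis
  proof (cases "b.typical_edges = {}")
    case True
    then have "n / 5 \<le> real (card ?P)" using a.large a.n by simp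
    then have "real (card ?R) \<le> 25 * \<gamma> * n" using prod by (rule cancel) simp
    then show ?thesis using that[of a.typical_edges] a.typical_edges_sub a.typical_edges_disjoint a.typical_edges_Y by blast
  next
    case False
    have "real (card Y) \<le> real (card ?R + card (\<Union> a.typical_edges))"
      using a.finite_Y finite_subset[OF a.typical_edges_Y a.finite_Y] card_Un_le[of ?R "\<Union> a.typical_edges"]
        card_mono[of "?R \<union> \<Union> a.typical_edges" Y] by fastforce
    then have "n / 5 \<le> real (card ?R)" 
      using cover[OF False] a.large(2) a.n(2) \<gamma>n unfolding of_nat_add by linarith
    moreover have "real (card ?R) * real (card ?P) \<le> 5 * \<gamma> * n\<^sup>2" using prod by (simp add: mult.commute)
    ultimately have "real (card ?P) \<le> 25 * \<gamma> * n" by (rule cancel) simp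
    then show ?thesis using that[of b.typical_edges] b.typical_edges_sub b.typical_edges_disjoint b.typical_edges_Y by blast
  qed
qed

section \<open>From edge and triangle counts to near-bipartiteness\<close>

lemma sum_crossing_codegree:
  assumes V: "finite V" "E \<subseteq> nsets V 2" and XY: "X \<union> Y = V" "X \<inter> Y = {}"
  shows "(\<Sum>(x, y)\<in>{(x, y) \<in> X \<times> Y. {x, y} \<in> E}. codegree E {x, y}) \<le> 2 * card (triangles E)"
proof -
  let ?C = "{(x, y) \<in> X \<times> Y. {x, y} \<in> E}"
  let ?h = "\<lambda>(x, y). {x, y}"
  have inj: "inj_on ?h ?C"
    using XY by (auto simp: inj_on_def doubleton_eq_iff)
  have sub: "?h ` ?C \<subseteq> E" by auto
  have cross: "a \<in> X \<and> b \<in> Y \<or> a \<in> Y \<and> b \<in> X" if "{a, b} \<in> ?h ` ?C" for a b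
    using that by (auto simp: doubleton_eq_iff)
  have "(\<Sum>(x, y)\<in>?C. codegree E {x, y}) = (\<Sum>p\<in>?C. (codegree E \<circ> ?h) p)"
    by (intro sum.cong) auto
  also have "\<dots> = (\<Sum>f\<in>?h ` ?C. codegree E f)"
    using inj by (rule sum.reindex[symmetric])
  also have "\<dots> = (\<Sum>T\<in>triangles E. card (?h ` ?C \<inter> nsets T 2))"
    by (rule sum_codegree[OF V sub])
  also have "\<dots> \<le> (\<Sum>T\<in>triangles E. 2)"
  proof (rule sum_mono)
    fix T assume T: "T \<in> triangles E"
    \<comment> \<open>Two of the three vertices lie on the same side, so a triangle has at most two
      crossing edges.\<close>
    have "\<not> nsets T 2 \<subseteq> ?h ` ?C"
    proof
      assume sub: "nsets T 2 \<subseteq> ?h ` ?C"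
      obtain a b c where abc: "T = {a, b, c}" "a \<noteq> b" "a \<noteq> c" "b \<noteq> c"
        using T by (rule trianglesE)
      have "{a, b} \<in> ?h ` ?C" "{a, c} \<in> ?h ` ?C" "{b, c} \<in> ?h ` ?C"
        using sub unfolding abc(1) nsets_2_triple[OF abc(2-4)] by blast+
      from this[THEN cross] show False using XY(2) by blast
    qed
    then have "?h ` ?C \<inter> nsets T 2 \<subset> nsets T 2" by blast
    moreover have "finite (nsets T 2)"
      using card_nsets_2_triangle[OF T] by (intro card_ge_0_finite) simp
    ultimately have "card (?h ` ?C \<inter> nsets T 2) < card (nsets T 2)"
      by (intro psubset_card_mono)
    then show "card (?h ` ?C \<inter> nsets T 2) \<le> 2"
      using card_nsets_2_triangle[OF T] by simp
  qed
  finally show ?thesis by simp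
qed

text \<open>Crossing edges have codegree at least 1 and total codegree at most twice the number of
  triangles, about \<open>n^2 / 4\<close>, which is also about their number. Hence the excess is at
  most \<open>3 * \<kappa> * n^2\<close>, and nearly all cross pairs are edges of codegree exactly
  1.\<close>

lemma near_bipartiteI:
  fixes n \<kappa> \<gamma> :: real
  assumes V: "finite V" "E \<subseteq> nsets V 2" and XY: "X \<union> Y = V" "X \<inter> Y = {}"
    and cov: "\<forall>f\<in>E. \<exists>T\<in>triangles E. f \<subseteq> T"
    and n: "n = real (card V)" "n > 0" and \<gamma>: "0 < \<gamma>" "\<gamma> \<le> 1 / 100" "4 * \<kappa> \<le> \<gamma>\<^sup>2"
    and t: "real (card (triangles E)) \<le> (1 / 8 + \<kappa>) * n\<^sup>2"
    and cross: "(1 / 4 - \<kappa>) * n\<^sup>2 \<le> real (card {(x, y) \<in> X \<times> Y. {x, y} \<in> E})"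
  shows "near_bipartite V E X Y n \<gamma>" "\<bar>real (card X) - n / 2\<bar> \<le> \<gamma> / 2 * n" "\<bar>real (card Y) - n / 2\<bar> \<le> \<gamma> / 2 * n"
proof -
  let ?C = "{(x, y) \<in> X \<times> Y. {x, y} \<in> E}"
  have fXY: "finite X" "finite Y" using V(1) XY(1) by auto
  have codegree_pos: "codegree E {x, y} \<ge> 1" if e: "{x, y} \<in> E" for x y
  proof -
    obtain T where "T \<in> triangles E" "{x, y} \<subseteq> T" using cov e by blast
    then have "{T \<in> triangles E. {x, y} \<subseteq> T} \<noteq> {}" by blast
    then have "card {T \<in> triangles E. {x, y} \<subseteq> T} \<noteq> 0"
      using finite_triangles[OF V] by simp
    then show ?thesis using codegree_eq_triangles[OF V e] by simp
  qed
  define ex where "ex x y = (if {x, y} \<in> E then codegree E {x, y} - 1 else 0)" for x y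
  have dsum: "(\<Sum>y\<in>Y. \<Sum>x\<in>X. g x y) = (\<Sum>(x, y)\<in>X \<times> Y. g x y)" for g :: "'a \<Rightarrow> 'a \<Rightarrow> nat"
    by (subst sum.swap) (rule sum.cartesian_product)
  have cC: "card ?C = (\<Sum>(x, y)\<in>X \<times> Y. if {x, y} \<in> E then 1 else 0)"
  proof -
    have "(\<Sum>(x, y)\<in>X \<times> Y. if {x, y} \<in> E then 1 else 0) = (\<Sum>p\<in>X \<times> Y. if p \<in> ?C then 1 else 0 :: nat)"
      by (intro sum.cong) (auto split: if_splits)
    also have "\<dots> = (\<Sum>p\<in>(X \<times> Y) \<inter> ?C. 1)"
      by (rule sum.inter_restrict[symmetric]) (use fXY in simp)
    also have "(X \<times> Y) \<inter> ?C = ?C" by auto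
    finally show ?thesis by simp
  qed
  have "card ?C + (\<Sum>(x, y)\<in>X \<times> Y. ex x y)
      = (\<Sum>p\<in>X \<times> Y. if p \<in> ?C then (case p of (x, y) \<Rightarrow> codegree E {x, y}) else 0)"
    unfolding cC sum.distrib[symmetric]
  proof (intro sum.cong refl, clarify)
    fix x y assume "x \<in> X" "y \<in> Y"
    then show "(if {x, y} \<in> E then 1 else 0) + ex x y = (if (x, y) \<in> ?C then codegree E {x, y} else 0)"
      using codegree_pos[of x y] by (auto simp: ex_def)
  qed
  also have "\<dots> = (\<Sum>p\<in>(X \<times> Y) \<inter> ?C. case p of (x, y) \<Rightarrow> codegree E {x, y})"
    by (rule sum.inter_restrict[symmetric]) (use fXY in simp)
  also have "(X \<times> Y) \<inter> ?C = ?C" by auto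
  also have "(\<Sum>(x, y)\<in>?C. codegree E {x, y}) \<le> 2 * card (triangles E)"
    by (rule sum_crossing_codegree[OF V XY])
  finally have "real (card ?C + (\<Sum>(x, y)\<in>X \<times> Y. ex x y)) \<le> real (2 * card (triangles E))"
    unfolding of_nat_le_iff .
  then have excess: "real (\<Sum>(x, y)\<in>X \<times> Y. ex x y) \<le> 3 * \<kappa> * n\<^sup>2"
    using t cross unfolding of_nat_add of_nat_mult by (simp add: algebra_simps)
  \<comment> \<open>Pointwise, a cross pair that is an edge without being good has excess at least
    1, as codegree 0 is ruled out by \<open>cov\<close>.\<close>
  have "card ?C + (\<Sum>(x, y)\<in>X \<times> Y. if \<not> good_pair E x y then 1 else 0)
      \<le> (\<Sum>(x, y)\<in>X \<times> Y. 1 + ex x y)"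
    unfolding cC sum.distrib[symmetric]
  proof (intro sum_mono, clarify)
    fix x y
    show "(if {x, y} \<in> E then 1 else 0) + (if \<not> good_pair E x y then 1 else 0) \<le> 1 + ex x y"
      using codegree_pos[of x y] by (auto simp: ex_def good_pair_def)
  qed
  also have "\<dots> = card X * card Y + (\<Sum>(x, y)\<in>X \<times> Y. ex x y)"
    by (simp add: case_prod_beta sum_Suc card_cartesian_product)
  finally have "real (card ?C + (\<Sum>(x, y)\<in>X \<times> Y. if \<not> good_pair E x y then 1 else 0))
      \<le> real (card X * card Y + (\<Sum>(x, y)\<in>X \<times> Y. ex x y))"
    unfolding of_nat_le_iff .
  then have bad0: "real (card ?C) + real (\<Sum>(x, y)\<in>X \<times> Y. if \<not> good_pair E x y then 1 else 0)
      \<le> real (card X) * real (card Y) + 3 * \<kappa> * n\<^sup>2"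
    using excess unfolding of_nat_add of_nat_mult by linarith
  have nXY: "n = real (card X) + real (card Y)"
    unfolding n(1) XY(1)[symmetric] using card_Un_disjoint[OF fXY XY(2)] by simp
  \<comment> \<open>The identity serves twice: it bounds the number of cross pairs by
    \<open>n^2 / 4\<close>, and it forces the sides to be balanced since nearly
    \<open>n^2 / 4\<close> cross pairs exist.\<close>
  have sq: "real (card X) * real (card Y) = n\<^sup>2 / 4 - (real (card X) - n / 2)\<^sup>2"
    unfolding nXY by (simp add: power2_eq_square field_simps)
  have bad: "real (\<Sum>(x, y)\<in>X \<times> Y. if \<not> good_pair E x y then 1 else 0) \<le> 4 * \<kappa> * n\<^sup>2"
  proof -
    have "n\<^sup>2 / 4 - \<kappa> * n\<^sup>2 \<le> real (card ?C)" using cross by (simp add: left_diff_distrib)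
    then show ?thesis
      using bad0 zero_le_power2[of "real (card X) - n / 2"] unfolding sq by linarith
  qed
  have \<kappa>: "4 * \<kappa> * n\<^sup>2 \<le> \<gamma>\<^sup>2 * n\<^sup>2" using \<gamma>(3) by (intro mult_right_mono) auto
  have "?C \<subseteq> X \<times> Y" by auto
  then have "card ?C \<le> card X * card Y"
    unfolding card_cartesian_product[symmetric] using fXY by (intro card_mono) auto
  then have "real (card ?C) \<le> real (card X) * real (card Y)"
    unfolding of_nat_mult[symmetric] of_nat_le_iff .
  then have "4 * (real (card X) - n / 2)\<^sup>2 \<le> 4 * \<kappa> * n\<^sup>2"
    using cross unfolding sq by (simp add: algebra_simps)
  then have "(real (card X) - n / 2)\<^sup>2 \<le> (\<gamma> / 2 * n)\<^sup>2"
    using \<kappa> by (simp add: power_mult_distrib power_divide)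
  then show sX: "\<bar>real (card X) - n / 2\<bar> \<le> \<gamma> / 2 * n"
    using \<gamma>(1) n(2) abs_le_square_iff[of "real (card X) - n / 2" "\<gamma> / 2 * n"] by simp
  then show sY: "\<bar>real (card Y) - n / 2\<bar> \<le> \<gamma> / 2 * n"
    using nXY by linarith
  have "\<gamma> * n \<le> (1 / 100) * n" using \<gamma> n by (intro mult_right_mono) auto
  then have large: "n / 4 \<le> real (card X)" "n / 4 \<le> real (card Y)"
    using sX sY n(2) by linarith+
  show "near_bipartite V E X Y n \<gamma>"
  proof
    have "0 \<le> real (\<Sum>(x, y)\<in>X \<times> Y. ex x y)" by (rule of_nat_0_le_iff)
    then have "3 * \<kappa> * n\<^sup>2 \<le> 4 * \<kappa> * n\<^sup>2" using excess by linarith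
    then show "real (\<Sum>y\<in>Y. \<Sum>x\<in>X. if {x, y} \<in> E then codegree E {x, y} - 1 else 0) \<le> \<gamma>\<^sup>2 * n\<^sup>2"
      unfolding dsum using excess \<kappa> unfolding ex_def by linarith
    have "(\<Sum>y\<in>Y. card {x \<in> X. \<not> good_pair E x y}) = (\<Sum>y\<in>Y. \<Sum>x\<in>X. if \<not> good_pair E x y then 1 else 0)"
      using fXY by (intro sum.cong refl) (simp add: sum.If_cases Int_def)
    then show "real (\<Sum>y\<in>Y. card {x \<in> X. \<not> good_pair E x y}) \<le> \<gamma>\<^sup>2 * n\<^sup>2"
      unfolding dsum using bad \<kappa> by linarith
  qed (use V XY n \<gamma> large in auto)
qed

section \<open>Saturating antichains as graphs\<close>

text \<open>Antichain: pairs inside a triangle are edges and hence not members. Saturation: a set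
  containing a non-edge contains a member; a clique with at least three vertices contains a
  triangle; a smaller set extends to a pair, which is a non-edge or lies in a triangle by
  \<open>cov\<close>.\<close>

lemma saturating_family:
  assumes V: "finite V" "E \<subseteq> nsets V 2" "2 \<le> card V"
    and cov: "\<forall>f\<in>E. \<exists>T\<in>triangles E. f \<subseteq> T"
  shows "saturating_antichain V ((nsets V 2 - E) \<union> triangles E)"
  unfolding saturating_antichain_def antichain_def
proof (intro conjI ballI)
  let ?F = "(nsets V 2 - E) \<union> triangles E"
  have tri: "triangles E \<subseteq> nsets V 3" by (rule triangles_subset[OF V(2)])
  then show "?F \<subseteq> Pow V" by (auto simp: nsets_def)
  fix S T assume S: "S \<in> ?F" and T: "T \<in> ?F"
  show "\<not> S \<subset> T"
  proof
    assume ST: "S \<subset> T"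
    have fT: "finite T" and cT: "card T \<le> 3" using T tri by (auto simp: nsets_def)
    have cS: "card S < card T" using ST fT by (rule psubset_card_mono[rotated])
    have "card S \<noteq> 3" using cS cT by linarith
    then have S2: "S \<in> nsets V 2 - E" using S by (auto simp: triangles_def)
    then have "card T \<noteq> 2" using cS by (auto simp: nsets_def)
    then have "T \<in> triangles E" using T by (auto simp: nsets_def)
    then have "nsets T 2 \<subseteq> E" by (simp add: triangles_def)
    moreover have "S \<in> nsets T 2" using S2 ST by (auto simp: nsets_def)
    ultimately show False using S2 by blast
  qed
next
  let ?F = "(nsets V 2 - E) \<union> triangles E"
  fix S assume "S \<in> Pow V - ?F"
  then have SV: "S \<subseteq> V" and fS: "finite S" using V(1) finite_subset by auto
  show "\<exists>T\<in>?F. S \<subseteq> T \<or> T \<subseteq> S"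
  proof (cases "nsets S 2 \<subseteq> E")
    case False
    then obtain p where p: "p \<in> nsets S 2" "p \<notin> E" by blast
    then have "p \<in> ?F" using nsets_mono[OF SV] by blast
    moreover have "p \<subseteq> S" using p by (simp add: nsets_def)
    ultimately show ?thesis by blast
  next
    case True
    show ?thesis
    proof (cases "card S \<ge> 3")
      case True
      then obtain T where T: "T \<subseteq> S" "card T = 3" "finite T"
        by (rule obtain_subset_with_card_n)
      then have "T \<in> triangles E"
        using \<open>nsets S 2 \<subseteq> E\<close> nsets_mono[OF T(1)] by (auto simp: triangles_def)
      then show ?thesis using T by blast
    next
      case False
      obtain p where p: "S \<subseteq> p" "p \<subseteq> V" "card p = 2"
        using exists_subset_between[of S 2 V] False V SV by auto
      then have p2: "p \<in> nsets V 2" using V(1) finite_subset by (auto simp: nsets_def)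
      show ?thesis
      proof (cases "p \<in> E")
        case True
        then obtain T where "T \<in> triangles E" "p \<subseteq> T" using cov by auto
        then show ?thesis using p(1) by (intro bexI[of _ T]) auto
      next
        case False
        then show ?thesis using p2 p(1) by (intro bexI[of _ p]) auto
      qed
    qed
  qed
qed

text \<open>Converse of \<open>saturating_family\<close>. A missing pair is comparable to some
  member, which must be a triple, and all pairs in a member triple are missing. A triangle of
  missing pairs outside \<open>F\<close> would have to contain a member pair, which is
  impossible.\<close>

lemma saturating_antichain_2_3_graph:
  assumes "saturating_antichain_2_3 n F"
  defines "E \<equiv> nsets {1..n} 2 - F"
  shows "\<forall>f\<in>E. \<exists>T\<in>triangles E. f \<subseteq> T" "F = (nsets {1..n} 2 - E) \<union> triangles E"
proof -
  let ?V = "{1..n}"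
  have F: "F \<subseteq> nsets ?V 2 \<union> nsets ?V 3"
    and anti: "\<And>S T. S \<in> F \<Longrightarrow> T \<in> F \<Longrightarrow> \<not> S \<subset> T"
    and sat: "\<And>S. S \<subseteq> ?V \<Longrightarrow> S \<notin> F \<Longrightarrow> \<exists>T\<in>F. S \<subseteq> T \<or> T \<subseteq> S"
    using assms(1)
    by (auto simp: saturating_antichain_2_3_def saturating_antichain_def antichain_def)
  have tri: "T \<in> triangles E" if T: "T \<in> F" "T \<in> nsets ?V 3" for T
  proof -
    have "g \<in> E" if g: "g \<in> nsets T 2" for g
    proof -
      have "g \<in> nsets ?V 2" using g T(2) by (auto simp: nsets_def)
      moreover have "g \<subset> T" using g T(2) by (auto simp: nsets_def)
      ultimately show ?thesis using anti[of g T] T(1) by (auto simp: E_def)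
    qed
    then show ?thesis using T(2) by (auto simp: triangles_def nsets_def)
  qed
  have eq: "S = T" if "S \<subseteq> T" "S \<in> nsets ?V k" "T \<in> nsets ?V k" for S T k
    using that by (auto simp: nsets_def dest: card_subset_eq)
  show "\<forall>f\<in>E. \<exists>T\<in>triangles E. f \<subseteq> T"
  proof
    fix f assume f: "f \<in> E"
    then have f': "f \<in> nsets ?V 2" "f \<notin> F" by (auto simp: E_def)
    then obtain T where T: "T \<in> F" "f \<subseteq> T \<or> T \<subseteq> f" using sat[of f] by (auto simp: nsets_def)
    have "T \<notin> nsets ?V 2" using eq[of f T 2] eq[of T f 2] f' T by auto
    then have T3: "T \<in> nsets ?V 3" using F T(1) by blast
    then have "\<not> T \<subseteq> f" using f' by (auto simp: nsets_def dest: card_mono)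
    then show "\<exists>T\<in>triangles E. f \<subseteq> T" using T tri[OF T(1) T3] by blast
  qed
  have "triangles E \<subseteq> F"
  proof (rule subsetI, rule ccontr)
    fix T assume T: "T \<in> triangles E" "T \<notin> F"
    have T3: "T \<in> nsets ?V 3" using T(1) triangles_subset[of E ?V] by (auto simp: E_def)
    then obtain S where S: "S \<in> F" "T \<subseteq> S \<or> S \<subseteq> T" using sat[of T] T(2) by (auto simp: nsets_def)
    have "S \<notin> nsets ?V 3" using eq[of S T 3] eq[of T S 3] T3 T S by auto
    then have S2: "S \<in> nsets ?V 2" using F S(1) by blast
    then have "\<not> T \<subseteq> S" using T3 by (auto simp: nsets_def dest: card_mono)
    then have "S \<in> nsets T 2" using S(2) S2 by (auto simp: nsets_def)
    then have "S \<in> E" using T(1) by (auto simp: triangles_def)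
    then show False using S(1) by (simp add: E_def)
  qed
  then show "F = (nsets ?V 2 - E) \<union> triangles E"
    using F tri by (auto simp: E_def)
qed

lemma card_graph_family:
  assumes V: "finite V" "E \<subseteq> nsets V 2"
  shows "real (card ((nsets V 2 - E) \<union> triangles E))
    = real (card V) * (real (card V) - 1) / 2 - real (card E) + real (card (triangles E))"
proof -
  have fin: "finite (nsets V 2)" using V(1) by (rule finite_imp_finite_nsets)
  have "(nsets V 2 - E) \<inter> triangles E = {}" by (auto simp: nsets_def triangles_def)
  then have "card ((nsets V 2 - E) \<union> triangles E) = card (nsets V 2 - E) + card (triangles E)"
    using fin finite_triangles[OF V] by (intro card_Un_disjoint) auto
  moreover have "card (nsets V 2 - E) + card E = card (nsets V 2)"
    using fin V(2) card_mono[OF fin V(2)] by (simp add: card_Diff_subset finite_subset)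
  moreover have "real (card (nsets V 2)) = real (card V) * (real (card V) - 1) / 2"
    using V(1) by (cases "card V") (auto simp: card_nsets choose_two real_of_nat_div algebra_simps)
  ultimately show ?thesis by linarith
qed

section \<open>The graph belonging to a matching family\<close>

locale matching_context =
  fixes n :: nat and C :: "nat set" and M :: "nat set set"
  assumes C: "C \<subseteq> {1..n}" and M: "M \<subseteq> nsets ({1..n} - C) 2" and disj: "disjoint M"
begin

abbreviation "V \<equiv> {1..n}"
abbreviation "shadow_graph \<equiv> shadow V 3 (matching_triples n C M)"

lemma M_edge: "m \<in> M \<Longrightarrow> m \<subseteq> V - C \<and> card m = 2 \<and> finite m"
  using M by (auto simp: nsets_def)

lemma M_C: "\<Union> M \<inter> C = {}" using M_edge by blast

lemma M_unique: "m \<in> M \<Longrightarrow> m' \<in> M \<Longrightarrow> v \<in> m \<Longrightarrow> v \<in> m' \<Longrightarrow> m = m'"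
  using disjointD[OF disj] by blast

text \<open>Since matching edges avoid \<open>C\<close>, a triple meeting \<open>C\<close> and
  containing a matching edge is that edge plus one vertex of \<open>C\<close>. The decomposition is
  unique, which gives \<open>card_triples\<close>.\<close>

lemma triples_eq: "matching_triples n C M = (\<lambda>(m, c). insert c m) ` (M \<times> C)"
proof (intro equalityI subsetI)
  fix G assume "G \<in> matching_triples n C M"
  then obtain c m where G: "G \<in> nsets V 3" "c \<in> G" "c \<in> C" "m \<in> M" "m \<subset> G"
    by (auto simp: matching_triples_def)
  have "c \<notin> m" using M_edge[OF G(4)] G(3) by blast
  then have "card (insert c m) = 3" using M_edge[OF G(4)] by simp
  moreover have "insert c m \<subseteq> G" using G by blast
  ultimately have "insert c m = G" using G(1) card_subset_eq[of G "insert c m"] by (auto simp: nsets_def)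
  then show "G \<in> (\<lambda>(m, c). insert c m) ` (M \<times> C)" using G by force
next
  fix G assume "G \<in> (\<lambda>(m, c). insert c m) ` (M \<times> C)"
  then obtain m c where G: "G = insert c m" "m \<in> M" "c \<in> C" by auto
  have "c \<notin> m" using M_edge[OF G(2)] G(3) by blast
  moreover have "c \<in> V" using G(3) C by blast
  ultimately show "G \<in> matching_triples n C M"
    using G M_edge[OF G(2)] by (auto simp: matching_triples_def nsets_def)
qed

lemma card_triples: "card (matching_triples n C M) = card M * card C"
proof -
  have "inj_on (\<lambda>(m, c). insert c m) (M \<times> C)"
  proof (rule inj_onI, clarify)
    fix m c m' c' assume a: "m \<in> M" "c \<in> C" "m' \<in> M" "c' \<in> C" "insert c m = insert c' m'"
    then have "m \<inter> C = {}" "m' \<inter> C = {}" using M_edge by blast+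
    then have "c \<notin> m" "c' \<notin> m'" "c \<notin> m'" using a(2,4) by blast+
    moreover have "c \<in> insert c' m'" unfolding a(5)[symmetric] by simp
    ultimately have "c = c'" "m = m'" using a(5) by (auto dest: insert_ident)
    then show "m = m' \<and> c = c'" by simp
  qed
  then show ?thesis unfolding triples_eq by (simp add: card_image card_cartesian_product)
qed

lemma shadow_graph_sub: "shadow_graph \<subseteq> nsets V 2" by (auto simp: shadow_def)

lemma shadow_graph_cases:
  assumes "f \<in> shadow_graph"
  obtains "f \<in> M" | v c where "f = {v, c}" "v \<in> \<Union> M" "c \<in> C"
proof -
  obtain m c where f: "f \<in> nsets V 2" "m \<in> M" "c \<in> C" "f \<subset> insert c m"
    using assms by (auto simp: shadow_def triples_eq)
  show thesis
  proof (cases "c \<in> f")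
    case False
    then have "f \<subseteq> m" using f by blast
    then have "f = m" using f(1) M_edge[OF f(2)] card_subset_eq[of m f] by (auto simp: nsets_def)
    then show thesis using that(1) f(2) by blast
  next
    case True
    obtain x y where xy: "f = {x, y}" "x \<noteq> y" using f(1) by (rule nsets2_E)
    define v where "v = (if x = c then y else x)"
    have v: "f = {v, c}" "v \<noteq> c" using xy True by (auto simp: v_def)
    then have "v \<in> \<Union> M" using f by blast
    then show thesis using that(2) v(1) f(3) by blast
  qed
qed

lemma shadow_graph_cross: "v \<in> \<Union> M \<Longrightarrow> c \<in> C \<Longrightarrow> {v, c} \<in> shadow_graph"
proof -
  assume v: "v \<in> \<Union> M" and c: "c \<in> C"
  then obtain m where m: "m \<in> M" "v \<in> m" by blast
  have "c \<notin> m" using M_edge[OF m(1)] c by blast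
  then have "card (insert c m) = 3" using M_edge[OF m(1)] by simp
  moreover have "card {v, c} \<le> 2" by (simp add: card_insert_if)
  ultimately have "{v, c} \<noteq> insert c m" by auto
  then have "{v, c} \<subset> insert c m" using m by blast
  moreover have "{v, c} \<in> nsets V 2" using M_edge[OF m(1)] m(2) c C \<open>c \<notin> m\<close> by auto
  moreover have "insert c m \<in> matching_triples n C M" unfolding triples_eq using m(1) c by force
  ultimately show "{v, c} \<in> shadow_graph" unfolding shadow_def by auto
qed

text \<open>Shadow edges are matching edges or join a matched vertex to \<open>C\<close>, so no
  shadow edge lies inside \<open>C\<close>. Two matching edges in a triangle would share a vertex,
  so a triangle is a matching edge with a vertex of \<open>C\<close>. Thus the matching family is
  the family of its shadow graph.\<close>

lemma triangles_shadow_graph: "triangles shadow_graph = matching_triples n C M"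
proof (intro equalityI subsetI)
  fix T assume T: "T \<in> matching_triples n C M"
  then have T3: "T \<in> nsets V 3" by (simp add: matching_triples_def)
  have "g \<in> shadow_graph" if "g \<in> nsets T 2" for g
    using that T T3 unfolding shadow_def by (auto simp: nsets_def intro!: bexI[of _ T])
  then show "T \<in> triangles shadow_graph" using T3 by (auto simp: triangles_def nsets_def)
next
  fix T assume "T \<in> triangles shadow_graph"
  then obtain x y z where T: "T = {x, y, z}" "x \<noteq> y" "x \<noteq> z" "y \<noteq> z"
    "{x, y} \<in> shadow_graph" "{x, z} \<in> shadow_graph" "{y, z} \<in> shadow_graph" by (rule trianglesE)
  have edge: "{u, v} \<in> M \<and> u \<notin> C \<and> v \<notin> C \<or> u \<in> C \<and> v \<notin> C \<or> v \<in> C \<and> u \<notin> C" if "{u, v} \<in> shadow_graph" for u v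
    using that
  proof (cases rule: shadow_graph_cases)
    case 1
    then show ?thesis using M_C by blast
  next
    case (2 a c)
    then show ?thesis using M_C by (auto simp: doubleton_eq_iff)
  qed
  have tri: "{u, v, w} \<in> matching_triples n C M" if "{u, v} \<in> M" "w \<in> C" for u v w
  proof -
    have "{u, v, w} = insert w {u, v}" by auto
    then show ?thesis unfolding triples_eq using that by force
  qed
  from edge[OF T(5)] edge[OF T(6)] edge[OF T(7)]
  consider "{x, y} \<in> M" "{x, z} \<in> M" | "{x, y} \<in> M" "z \<in> C" | "{x, z} \<in> M" "y \<in> C" | "{y, z} \<in> M" "x \<in> C"
    by blast
  then show "T \<in> matching_triples n C M"
  proof cases
    case 1
    then have "{x, y} = {x, z}" by (rule M_unique[where v = x]) auto
    then show ?thesis using T(2-4) by (auto simp: doubleton_eq_iff)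
  next
    case 2
    then show ?thesis using tri[of x y z] T(1) by simp
  next
    case 3
    then show ?thesis using tri[of x z y] T(1) by (simp add: insert_commute)
  next
    case 4
    then show ?thesis using tri[of y z x] T(1) by (simp add: insert_commute)
  qed
qed

lemma family_eq: "matching_family n C M = (nsets V 2 - shadow_graph) \<union> triangles shadow_graph"
  unfolding matching_family_def matching_pairs_def triangles_shadow_graph ..

lemma saturating:
  assumes "2 \<le> n"
  shows "saturating_antichain V (matching_family n C M)"
  unfolding family_eq
proof (rule saturating_family)
  show "\<forall>f\<in>shadow_graph. \<exists>T\<in>triangles shadow_graph. f \<subseteq> T" unfolding triangles_shadow_graph by (auto simp: shadow_def)
qed (use shadow_graph_sub assms in auto)

lemma card_Union_M: "card (\<Union> M) = 2 * card M"
proof -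
  have "card (\<Union> M) = sum card M"
    using disj M_edge by (intro card_Union_disjoint) auto
  also have "\<dots> = (\<Sum>m\<in>M. 2)" using M_edge by (intro sum.cong) auto
  finally show ?thesis by simp
qed

text \<open>Only the pairs between matched vertices and \<open>C\<close> are counted; the matching
  edges themselves are of lower order.\<close>

lemma card_shadow_graph: "2 * card M * card C \<le> card shadow_graph"
proof -
  have "inj_on (\<lambda>(v, c). {v, c}) (\<Union> M \<times> C)"
    using M_C by (auto simp: inj_on_def doubleton_eq_iff)
  moreover have "(\<lambda>(v, c). {v, c}) ` (\<Union> M \<times> C) \<subseteq> shadow_graph" using shadow_graph_cross by auto
  moreover have "finite shadow_graph" by (rule finite_edges[OF _ shadow_graph_sub]) simp
  ultimately have "card (\<Union> M \<times> C) \<le> card shadow_graph" by (rule card_inj_on_le)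
  then show ?thesis by (simp add: card_cartesian_product card_Union_M)
qed

text \<open>A shadow edge outside \<open>M\<close> consists of a vertex of \<open>C\<close> and a
  matched vertex, and the latter determines its matching edge.\<close>

lemma triple_unique:
  assumes "f \<in> shadow_graph" "f \<notin> M" "f \<subseteq> S" "f \<subseteq> T" "S \<in> matching_triples n C M" "T \<in> matching_triples n C M"
  shows "S = T"
proof -
  obtain v c where f: "f = {v, c}" "v \<in> \<Union> M" "c \<in> C" using shadow_graph_cases[OF assms(1)] assms(2) by blast
  have *: "\<exists>m\<in>M. v \<in> m \<and> T = insert c m" if fT: "f \<subseteq> T" "T \<in> matching_triples n C M" for T
  proof -
    obtain m d where T: "T = insert d m" "m \<in> M" "d \<in> C" using fT(2) by (auto simp: triples_eq)
    have "m \<inter> C = {}" "v \<notin> C" using M_edge[OF T(2)] f(2) M_C by blast+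
    then have "c = d" "v \<in> m" using fT(1) T f by auto
    then show ?thesis using T by blast
  qed
  obtain m where m: "m \<in> M" "v \<in> m" "S = insert c m" using *[OF assms(3,5)] by blast
  obtain m' where m': "m' \<in> M" "v \<in> m'" "T = insert c m'" using *[OF assms(4,6)] by blast
  show ?thesis using M_unique[OF m(1) m'(1) m(2) m'(2)] m(3) m'(3) by simp
qed

end

text \<open>One end of every matching edge goes to \<open>A\<close>, the other to \<open>B\<close>,
  and both are padded to size \<open>k\<close> with unmatched vertices.\<close>

lemma matching_partition:
  assumes V: "finite V" "M \<subseteq> nsets V 2" and disj: "disjoint M" and k: "card M \<le> k" "2 * k \<le> card V"
  obtains A B where "A \<subseteq> V" "B \<subseteq> V" "A \<inter> B = {}" "card A = k" "card B = k"
    "matching_between A B M" "\<Union> M \<subseteq> A \<union> B"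
proof -
  have fM: "finite M" using finite_edges[OF V] .
  have "\<forall>m\<in>M. \<exists>a b. m = {a, b} \<and> a \<noteq> b"
    using V(2) by (meson nsets2_E subsetD)
  then obtain a b where ab: "\<And>m. m \<in> M \<Longrightarrow> m = {a m, b m} \<and> a m \<noteq> b m" by metis
  have uniq: "m = m'" if "m \<in> M" "m' \<in> M" "v \<in> m" "v \<in> m'" for m m' v
    using disjointD[OF disj that(1,2)] that(3,4) by blast
  have in_m: "a m \<in> m" "b m \<in> m" if "m \<in> M" for m
    using ab[OF that] by auto
  have inj: "inj_on a M" "inj_on b M"
    using uniq in_m by (auto intro!: inj_onI) metis+
  have dis: "a ` M \<inter> b ` M = {}"
  proof (rule equals0I)
    fix v assume "v \<in> a ` M \<inter> b ` M"
    then obtain m m' where m: "m \<in> M" "m' \<in> M" "v = a m" "v = b m'" by blast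
    then have "m = m'" using uniq[of m m' v] in_m by metis
    then show False using ab m by metis
  qed
  have MV: "\<Union> M \<subseteq> V" using V(2) by (auto simp: nsets_def)
  then have sub: "a ` M \<subseteq> V" "b ` M \<subseteq> V" using in_m by blast+
  define R where "R = V - (a ` M \<union> b ` M)"
  have cab: "card (a ` M \<union> b ` M) = 2 * card M"
    using card_Un_disjoint[OF _ _ dis] fM inj by (simp add: card_image)
  have "card R = card V - 2 * card M"
    unfolding R_def cab[symmetric] using sub fM by (intro card_Diff_subset) auto
  then have "k - card M \<le> card R" using k by linarith
  then obtain A' where A': "A' \<subseteq> R" "card A' = k - card M" "finite A'"
    by (rule obtain_subset_with_card_n)
  have "card (R - A') = card R - card A'" using A' by (intro card_Diff_subset) auto
  then have "k - card M \<le> card (R - A')"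
    using k A'(2) \<open>card R = card V - 2 * card M\<close> by linarith
  then obtain B' where B': "B' \<subseteq> R - A'" "card B' = k - card M" "finite B'"
    by (rule obtain_subset_with_card_n)
  show ?thesis
  proof (rule that[of "a ` M \<union> A'" "b ` M \<union> B'"])
    show "a ` M \<union> A' \<subseteq> V" "b ` M \<union> B' \<subseteq> V" using sub A' B' by (auto simp: R_def)
    show "(a ` M \<union> A') \<inter> (b ` M \<union> B') = {}" using dis A' B' by (auto simp: R_def)
    have "card (a ` M \<union> A') = card (a ` M) + card A'"
      using fM A' by (intro card_Un_disjoint) (auto simp: R_def)
    then show "card (a ` M \<union> A') = k" using inj k A' by (simp add: card_image)
    have "card (b ` M \<union> B') = card (b ` M) + card B'"
      using fM B' by (intro card_Un_disjoint) (auto simp: R_def)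
    then show "card (b ` M \<union> B') = k" using inj k B' by (simp add: card_image)
    show "matching_between (a ` M \<union> A') (b ` M \<union> B') M"
      unfolding matching_between_def using ab disj by blast
    show "\<Union> M \<subseteq> a ` M \<union> A' \<union> (b ` M \<union> B')" using ab by blast
  qed
qed

section \<open>Distance between a given family and a matching family\<close>

lemma card_sym_diff_graph_families:
  assumes V: "finite V" "E \<subseteq> nsets V 2" "E' \<subseteq> nsets V 2"
  shows "card (sym_diff ((nsets V 2 - E) \<union> triangles E) ((nsets V 2 - E') \<union> triangles E'))
    \<le> card (E - E') + card (E' - E) + card (triangles E - triangles E') + card (triangles E' - triangles E)"
proof -
  let ?S = "(E - E') \<union> (E' - E) \<union> (triangles E - triangles E') \<union> (triangles E' - triangles E)"
  have fin: "finite ?S"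
    using finite_edges[OF V(1,2)] finite_edges[OF V(1,3)]
      finite_triangles[OF V(1,2)] finite_triangles[OF V(1,3)] by simp
  have "card (sym_diff ((nsets V 2 - E) \<union> triangles E) ((nsets V 2 - E') \<union> triangles E')) \<le> card ?S"
    using V(2,3) by (intro card_mono[OF fin]) blast
  also have "\<dots> \<le> card ((E - E') \<union> (E' - E) \<union> (triangles E - triangles E')) + card (triangles E' - triangles E)"
    by (rule card_Un_le)
  also have "card ((E - E') \<union> (E' - E) \<union> (triangles E - triangles E'))
      \<le> card ((E - E') \<union> (E' - E)) + card (triangles E - triangles E')"
    by (rule card_Un_le)
  also have "card ((E - E') \<union> (E' - E)) \<le> card (E - E') + card (E' - E)"
    by (rule card_Un_le)
  finally show ?thesis by simp
qed

lemma card_Diff_swap: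
  assumes "finite A" "finite B"
  shows "card (A - B) + card B = card (B - A) + card A"
proof -
  have "card (A - B) + card B = card (A \<union> B)"
    using assms card_Un_disjoint[of "A - B" B] by (simp add: Un_Diff_cancel2 Int_commute)
  moreover have "card (B - A) + card A = card (B \<union> A)"
    using assms card_Un_disjoint[of "B - A" A] by (simp add: Un_Diff_cancel2 Int_commute)
  ultimately show ?thesis by (simp add: Un_commute)
qed

context matching_context
begin

text \<open>Only the one-sided differences \<open>shadow_graph - E\<close> and missing triples are
  estimated directly; the opposite differences follow from comparing cardinalities. This turns the
  distance into a slack between \<open>card E + card (triangles E)\<close> and
  \<open>3 * (card M * card C)\<close>.\<close>

lemma card_sym_diff_family:
  assumes E: "E \<subseteq> nsets V 2" "M \<subseteq> E" and XY: "X \<union> Y = V" "\<Union> M \<subseteq> Y"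
  shows "card (sym_diff (matching_family n C M) ((nsets V 2 - E) \<union> triangles E)) + 3 * (card M * card C)
    \<le> 4 * (card {(x, y) \<in> X \<times> Y. {x, y} \<notin> E} + card (Y - \<Union> M) * n) + card E + card (triangles E)"
proof -
  let ?B = "{(x, y) \<in> X \<times> Y. {x, y} \<notin> E}" and ?W = "Y - \<Union> M"
  let ?Tr = "matching_triples n C M"
  have fXY: "finite X" "finite Y" using XY(1) by (metis finite_Un finite_atLeastAtMost)+
  have fE: "finite E" and finSH: "finite shadow_graph"
    using finite_edges[OF _ E(1)] finite_edges[OF _ shadow_graph_sub] by simp_all
  have fTE: "finite (triangles E)" and fTr: "finite ?Tr"
    using finite_triangles[OF _ E(1)] finite_triangles[OF _ shadow_graph_sub] triangles_shadow_graph by simp_all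
  have fB: "finite ?B" using fXY by (auto intro: finite_subset[of _ "X \<times> Y"])

  \<comment> \<open>A missing shadow edge has a matched end in \<open>Y\<close>. If its end in
    \<open>C\<close> lies in \<open>X\<close>, it is a missing cross pair; otherwise that end is an
    unmatched vertex of \<open>Y\<close>.\<close>
  have sub: "shadow_graph - E \<subseteq> (\<lambda>(x, y). {x, y}) ` (?B \<union> ?W \<times> V)"
  proof
    fix f assume f: "f \<in> shadow_graph - E"
    then have "f \<in> shadow_graph" "f \<notin> M" using E(2) by auto
    then obtain v c where vc: "f = {v, c}" "v \<in> \<Union> M" "c \<in> C"
      using shadow_graph_cases[of f] by blast
    have v: "v \<in> Y" "v \<in> V" using vc(2) XY by blast+
    have c: "c \<notin> \<Union> M" "c \<in> X \<or> c \<in> Y" using vc(3) M_C C XY(1) by blast+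
    have f': "f = {c, v}" using vc(1) by auto
    have "(c, v) \<in> ?B \<union> ?W \<times> V"
    proof (cases "c \<in> Y")
      case True
      then show ?thesis using c(1) v(2) by blast
    next
      case False
      then show ?thesis using c(2) v(1) f f' by auto
    qed
    then show "f \<in> (\<lambda>(x, y). {x, y}) ` (?B \<union> ?W \<times> V)"
      unfolding f' by (intro image_eqI[of _ _ "(c, v)"]) auto
  qed
  have "card (shadow_graph - E) \<le> card ((\<lambda>(x, y). {x, y}) ` (?B \<union> ?W \<times> V))"
    using fB fXY by (intro card_mono[OF _ sub]) auto
  also have "\<dots> \<le> card (?B \<union> ?W \<times> V)" using fB fXY by (intro card_image_le) auto
  also have "\<dots> \<le> card ?B + card (?W \<times> V)" by (rule card_Un_le)
  also have "card (?W \<times> V) = card ?W * n" by (simp add: card_cartesian_product)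
  finally have d: "card (shadow_graph - E) \<le> card ?B + card ?W * n" .

  \<comment> \<open>A triple that is not a triangle of \<open>E\<close> has a missing edge. That
    edge is not in \<open>M\<close>, so by \<open>triple_unique\<close> this assignment is
    injective.\<close>
  have "\<exists>f. f \<in> shadow_graph - E \<and> f \<subseteq> T" if T: "T \<in> ?Tr - triangles E" for T
  proof -
    have T3: "T \<in> triangles shadow_graph" using T triangles_shadow_graph by blast
    then have "nsets T 2 \<subseteq> shadow_graph" by (simp add: triangles_def)
    moreover have "\<not> nsets T 2 \<subseteq> E" using T3 T by (auto simp: triangles_def)
    ultimately show ?thesis by (auto simp: nsets_def)
  qed
  then obtain p where p: "\<And>T. T \<in> ?Tr - triangles E \<Longrightarrow> p T \<in> shadow_graph - E \<and> p T \<subseteq> T"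
    by metis
  have "inj_on p (?Tr - triangles E)"
  proof (rule inj_onI)
    fix S T assume ST: "S \<in> ?Tr - triangles E" "T \<in> ?Tr - triangles E" "p S = p T"
    show "S = T"
    proof (rule triple_unique)
      show "p S \<in> shadow_graph" "p S \<notin> M" "p S \<subseteq> S" using p[OF ST(1)] E(2) by auto
      show "p S \<subseteq> T" using p[OF ST(2)] ST(3) by simp
    qed (use ST in auto)
  qed
  moreover have "p ` (?Tr - triangles E) \<subseteq> shadow_graph - E" using p by blast
  ultimately have d': "card (?Tr - triangles E) \<le> card (shadow_graph - E)"
    using finSH by (intro card_inj_on_le) auto

  have "card (sym_diff (matching_family n C M) ((nsets V 2 - E) \<union> triangles E))
    \<le> card (shadow_graph - E) + card (E - shadow_graph) + card (?Tr - triangles E) + card (triangles E - ?Tr)"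
    using card_sym_diff_graph_families[OF _ shadow_graph_sub E(1)] unfolding family_eq triangles_shadow_graph by simp
  moreover have "card (E - shadow_graph) + card shadow_graph = card (shadow_graph - E) + card E"
    using fE finSH by (rule card_Diff_swap)
  moreover have "card (triangles E - ?Tr) + card M * card C = card (?Tr - triangles E) + card (triangles E)"
    using card_Diff_swap[OF fTE fTr] card_triples by simp
  moreover have "2 * (card M * card C) \<le> card shadow_graph" using card_shadow_graph by (simp add: mult.assoc)
  ultimately show ?thesis using d d' unfolding distrib_left by linarith
qed

end

text \<open>The main terms cancel: \<open>e + t\<close> is about \<open>3/8 * n^2\<close> and so is
  \<open>3 * (m * c)\<close>. What remains is dominated by \<open>4 * 25\<close> from
  \<open>w\<close> and \<open>3 * 13 / 2\<close> from \<open>m\<close>.\<close>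

lemma comparison_arith:
  fixes n \<gamma> \<kappa> y w m c b e t s :: real
  assumes n: "n > 0" and \<gamma>: "0 < \<gamma>" "\<gamma> \<le> 1 / 100" "4 * \<kappa> \<le> \<gamma>\<^sup>2"
    and w: "w \<le> 25 * \<gamma> * n" and m: "n / 4 - 13 * \<gamma> * n \<le> m" and c: "n / 2 \<le> c"
    and b: "b \<le> \<gamma>\<^sup>2 * n\<^sup>2" and e: "e \<le> (1 / 4 + \<kappa>) * n\<^sup>2" and t: "t \<le> (1 / 8 + \<kappa>) * n\<^sup>2"
    and s: "s + 3 * (m * c) \<le> 4 * (b + w * n) + e + t"
  shows "s \<le> 125 * \<gamma> * n\<^sup>2"
proof -
  have "13 * \<gamma> * n \<le> 13 * (1 / 100) * n" using \<gamma> n by (intro mult_right_mono mult_left_mono) auto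
  then have "0 \<le> m" using m n by linarith
  have "(n / 4 - 13 * \<gamma> * n) * (n / 2) \<le> m * (n / 2)" using m n by (intro mult_right_mono) auto
  also have "\<dots> \<le> m * c" using c \<open>0 \<le> m\<close> by (rule mult_left_mono)
  finally have mc: "n\<^sup>2 / 8 - 13 / 2 * (\<gamma> * n\<^sup>2) \<le> m * c"
    by (simp add: power2_eq_square algebra_simps)
  have "w * n \<le> (25 * \<gamma> * n) * n" using w n by (intro mult_right_mono) auto
  then have wn: "w * n \<le> 25 * (\<gamma> * n\<^sup>2)" by (simp add: power2_eq_square)
  have "\<gamma>\<^sup>2 \<le> \<gamma> * (1 / 100)" unfolding power2_eq_square using \<gamma> by (intro mult_left_mono) auto
  then have "\<gamma>\<^sup>2 * n\<^sup>2 \<le> \<gamma> * (1 / 100) * n\<^sup>2" by (intro mult_right_mono) auto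
  then have \<gamma>2: "\<gamma>\<^sup>2 * n\<^sup>2 \<le> (\<gamma> * n\<^sup>2) / 100" by simp
  have "4 * \<kappa> * n\<^sup>2 \<le> \<gamma>\<^sup>2 * n\<^sup>2" using \<gamma>(3) by (intro mult_right_mono) auto
  then have \<kappa>: "\<kappa> * n\<^sup>2 \<le> (\<gamma>\<^sup>2 * n\<^sup>2) / 4" by simp
  have et: "e \<le> n\<^sup>2 / 4 + \<kappa> * n\<^sup>2" "t \<le> n\<^sup>2 / 8 + \<kappa> * n\<^sup>2" using e t by (simp_all add: distrib_right)
  have "0 \<le> \<gamma> * n\<^sup>2" using \<gamma> by simp
  then have "s \<le> 125 * (\<gamma> * n\<^sup>2)"
    using \<gamma>2 \<kappa> et mc wn b s unfolding distrib_left by linarith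
  then show ?thesis by simp
qed

lemma matching_family_close:
  fixes n :: nat and \<gamma> \<kappa> :: real
  defines "V \<equiv> {1..n}"
  assumes E: "E \<subseteq> nsets V 2" "M\<^sub>0 \<subseteq> E" "disjoint M\<^sub>0" and XY: "X \<union> Y = V" "\<Union> M\<^sub>0 \<subseteq> Y"
    and n: "0 < n" "1 \<le> \<gamma> * real n" "2 \<le> n" and \<gamma>: "0 < \<gamma>" "\<gamma> \<le> 1 / 100" "4 * \<kappa> \<le> \<gamma>\<^sup>2"
    and Y: "\<bar>real (card Y) - real n / 2\<bar> \<le> \<gamma> / 2 * n"
    and W: "real (card (Y - \<Union> M\<^sub>0)) \<le> 25 * \<gamma> * n"
    and bad: "real (card {(x, y) \<in> X \<times> Y. {x, y} \<notin> E}) \<le> \<gamma>\<^sup>2 * (real n)\<^sup>2"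
    and e: "real (card E) \<le> (1 / 4 + \<kappa>) * (real n)\<^sup>2"
    and t: "real (card (triangles E)) \<le> (1 / 8 + \<kappa>) * (real n)\<^sup>2"
  obtains A B C M where "A \<union> B \<union> C = V" "A \<inter> B = {}" "A \<inter> C = {}" "B \<inter> C = {}"
    "card A = n div 4" "card B = n div 4" "matching_between A B M"
    "saturating_antichain V (matching_family n C M)"
    "real (card (sym_diff (matching_family n C M) ((nsets V 2 - E) \<union> triangles E))) \<le> 125 * \<gamma> * (real n)\<^sup>2"
proof -
  define k where "k = n div 4"
  have fV: "finite V" by (simp add: V_def)
  have fM0: "finite M\<^sub>0" using finite_edges[OF fV E(1)] E(2) finite_subset by blast
  have finite_Y: "finite Y" using fV XY(1) by (metis finite_Un)
  \<comment> \<open>The classes \<open>A\<close> and \<open>B\<close> have exactly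
    \<open>n div 4\<close> elements, so a larger matching is cut down to that many edges.\<close>
  have "\<exists>M\<subseteq>M\<^sub>0. card M = min (card M\<^sub>0) k"
    using obtain_subset_with_card_n[of "min (card M\<^sub>0) k" M\<^sub>0] by (metis min.cobounded1)
  then obtain M where M: "M \<subseteq> M\<^sub>0" "card M = min (card M\<^sub>0) k" by blast
  have ME: "M \<subseteq> E" using M(1) E(2) by blast
  have MV: "M \<subseteq> nsets V 2" using ME E(1) by blast
  have disj: "disjoint M" using E(3) M(1) by (auto simp: disjoint_def)
  have k: "card M \<le> k" "2 * k \<le> card V" using M(2) by (auto simp: k_def V_def)
  obtain A B where AB: "A \<subseteq> V" "B \<subseteq> V" "A \<inter> B = {}" "card A = k" "card B = k"
    "matching_between A B M" "\<Union> M \<subseteq> A \<union> B"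
    by (rule matching_partition[OF fV MV disj k])
  define C where "C = V - (A \<union> B)"
  have CV: "C \<subseteq> {1..n}" by (auto simp: C_def V_def)
  have "M \<subseteq> nsets ({1..n} - C) 2"
  proof
    fix m assume m: "m \<in> M"
    then have "m \<subseteq> A \<union> B" using AB(7) by blast
    then show "m \<in> nsets ({1..n} - C) 2"
      using m MV by (auto simp: nsets_def C_def V_def)
  qed
  then interpret mc: matching_context n C M
    using CV disj by unfold_locales
  have YM: "\<Union> M \<subseteq> Y" using M(1) XY(2) by blast
  have fAB: "finite A" "finite B" using AB fV finite_subset by blast+
  have "card (A \<union> B) = 2 * k" using card_Un_disjoint[OF fAB AB(3)] AB(4,5) by simp
  then have cC: "card C = n - 2 * k"
    unfolding C_def using AB fAB by (subst card_Diff_subset) (auto simp: V_def)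
  have c: "real n / 2 \<le> real (card C)" unfolding cC k_def by linarith
  have "card (Y - \<Union> M) + card (\<Union> M) = card Y"
    using finite_Y YM card_mono[OF finite_Y YM] by (simp add: card_Diff_subset finite_subset)
  then have w_eq: "real (card (Y - \<Union> M)) = real (card Y) - 2 * real (card M)"
    using mc.card_Union_M by linarith
  have wm: "real (card (Y - \<Union> M)) \<le> 25 * \<gamma> * n" "real n / 4 - 13 * \<gamma> * n \<le> real (card M)"
  proof -
    have \<gamma>n: "25 * \<gamma> * n = 25 * (\<gamma> * n)" "13 * \<gamma> * n = 13 * (\<gamma> * n)" "\<gamma> / 2 * n = (\<gamma> * n) / 2" by simp_all
    have "real (card (Y - \<Union> M)) \<le> 25 * \<gamma> * n \<and> real n / 4 - 13 * \<gamma> * n \<le> real (card M)"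
    proof (cases "card M\<^sub>0 \<le> k")
      case True
      then have "M = M\<^sub>0" using M fM0 by (simp add: card_subset_eq)
      then show ?thesis 
        using W[folded \<open>M = M\<^sub>0\<close>] w_eq Y n(2) unfolding \<gamma>n by (intro conjI) linarith+
    next
      case False
      then have "card M = k" using M(2) by simp
      \<comment> \<open>After truncation the matching has size \<open>n div 4\<close>; the rounding
        error is absorbed by \<open>1 \<le> \<gamma> * n\<close>.\<close>
      then have "real n / 4 - 1 \<le> real (card M)" unfolding k_def by linarith
      then show ?thesis using w_eq Y n(2) unfolding \<gamma>n by (intro conjI) linarith+
    qed
    then show "real (card (Y - \<Union> M)) \<le> 25 * \<gamma> * n" "real n / 4 - 13 * \<gamma> * n \<le> real (card M)"
      by simp_all
  qed
  let ?S = "sym_diff (matching_family n C M) ((nsets V 2 - E) \<union> triangles E)"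
  have "card ?S + 3 * (card M * card C)
    \<le> 4 * (card {(x, y) \<in> X \<times> Y. {x, y} \<notin> E} + card (Y - \<Union> M) * n) + card E + card (triangles E)"
    using mc.card_sym_diff_family[OF E(1)[unfolded V_def] ME XY(1)[unfolded V_def] YM] by (simp only: V_def)
  then have "real (card ?S + 3 * (card M * card C))
    \<le> real (4 * (card {(x, y) \<in> X \<times> Y. {x, y} \<notin> E} + card (Y - \<Union> M) * n) + card E + card (triangles E))"
    unfolding of_nat_le_iff .
  then have s: "real (card ?S) + 3 * (real (card M) * real (card C))
    \<le> 4 * (real (card {(x, y) \<in> X \<times> Y. {x, y} \<notin> E}) + real (card (Y - \<Union> M)) * real n)
      + real (card E) + real (card (triangles E))"
    unfolding of_nat_add of_nat_mult by simp
  have "real (card ?S) \<le> 125 * \<gamma> * (real n)\<^sup>2"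
    by (rule comparison_arith[OF _ \<gamma> wm c bad e t s]) (use n in simp)
  moreover have "saturating_antichain V (matching_family n C M)"
    using mc.saturating[OF n(3)] by (simp only: V_def)
  moreover have "A \<union> B \<union> C = V" "A \<inter> C = {}" "B \<inter> C = {}" using AB(1,2) by (auto simp: C_def)
  ultimately show ?thesis
    using that[of A B C M] AB(3-6) by (simp only: k_def)
qed

section \<open>Asymptotics\<close>

lemma saturating_antichain_2_3_ge_2:
  assumes "saturating_antichain_2_3 n F"
  shows "2 \<le> n"
proof (rule ccontr)
  assume "\<not> 2 \<le> n"
  \<comment> \<open>For \<open>n < 2\<close> the family would be empty, and then the empty set is
    comparable to no member.\<close>
  then have "nsets {1..n} 2 = {}" "nsets {1..n} 3 = {}"
    by (auto simp: nsets_eq_empty_iff)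
  then have "F = {}" using assms by (auto simp: saturating_antichain_2_3_def)
  then show False using assms by (auto simp: saturating_antichain_2_3_def saturating_antichain_def)
qed

lemma card_saturating_antichain:
  assumes "saturating_antichain_2_3 n F"
  defines "E \<equiv> nsets {1..n} 2 - F"
  shows "real (card F) = real n * (real n - 1) / 2 - real (card E) + real (card (triangles E))"
    "real (card (triangles E)) \<le> real (card F)"
proof -
  have sub: "E \<subseteq> nsets {1..n} 2" by (auto simp: E_def)
  have F: "F = (nsets {1..n} 2 - E) \<union> triangles E"
    using saturating_antichain_2_3_graph(2)[OF assms(1)] unfolding E_def .
  then show "real (card F) = real n * (real n - 1) / 2 - real (card E) + real (card (triangles E))"
    using card_graph_family[OF _ sub] by simp
  have "finite F"
    using F finite_triangles[OF _ sub] finite_imp_finite_nsets[of "{1..n}" 2] by simp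
  moreover have "triangles E \<subseteq> F" using F by blast
  ultimately have "card (triangles E) \<le> card F" by (rule card_mono)
  then show "real (card (triangles E)) \<le> real (card F)" by simp
qed

text \<open>The error \<open>5/2 * \<epsilon>\<close> consists of \<open>3/2 * \<epsilon>\<close>
  from \<open>edges_minus_triangles_le\<close> and \<open>\<epsilon>\<close> absorbing the linear
  term of \<open>n choose 2\<close>. If there are more than \<open>n^2 / 2\<close> triangles, they
  alone make \<open>F\<close> large enough.\<close>

lemma saturating_antichain_lower_bound:
  assumes F: "saturating_antichain_2_3 n F" and \<epsilon>: "0 < \<epsilon>" "\<epsilon> \<le> 1 / 2" "3 \<le> 2 * \<epsilon>\<^sup>2 * real n"
  shows "(3 / 8 - 5 / 2 * \<epsilon>) * (real n)\<^sup>2 \<le> real (card F)"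
proof -
  define E where "E = nsets {1..n} 2 - F"
  have sub: "E \<subseteq> nsets {1..n} 2" by (auto simp: E_def)
  have cov: "\<forall>f\<in>E. \<exists>T\<in>triangles E. f \<subseteq> T"
    using saturating_antichain_2_3_graph(1)[OF F] unfolding E_def .
  note card = card_saturating_antichain[OF F, folded E_def]
  have n: "real n = real (card {1..n})" by simp
  show ?thesis
  proof (cases "2 * real (card (triangles E)) \<le> (real n)\<^sup>2")
    case True
    have "real (card E) - real (card (triangles E)) \<le> (1 / 8 + 3 / 2 * \<epsilon>) * (real n)\<^sup>2"
      by (rule edges_minus_triangles_le[OF _ sub \<epsilon>(1,2) cov n \<epsilon>(3) True]) simp
    then have d: "real (card E) - real (card (triangles E)) \<le> (real n)\<^sup>2 / 8 + 3 / 2 * (\<epsilon> * (real n)\<^sup>2)"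
      by (simp add: distrib_right)
    have "2 * \<epsilon>\<^sup>2 * real n \<le> \<epsilon> * real n"
      using \<epsilon> mult_left_mono[of \<epsilon> "1 / 2" "2 * \<epsilon>"] by (intro mult_right_mono) (auto simp: power2_eq_square)
    then have "1 / 2 \<le> \<epsilon> * real n" using \<epsilon>(3) by linarith
    then have "1 / 2 * real n \<le> \<epsilon> * real n * real n" by (intro mult_right_mono) auto
    then have "real n / 2 \<le> \<epsilon> * (real n)\<^sup>2" by (simp add: power2_eq_square)
    moreover have "real n * (real n - 1) / 2 = (real n)\<^sup>2 / 2 - real n / 2"
      by (simp add: power2_eq_square field_simps)
    moreover have "(3 / 8 - 5 / 2 * \<epsilon>) * (real n)\<^sup>2 = 3 / 8 * (real n)\<^sup>2 - 5 / 2 * (\<epsilon> * (real n)\<^sup>2)"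
      by (simp add: algebra_simps)
    ultimately show ?thesis using d card(1) by linarith
  next
    case False
    have "(3 / 8 - 5 / 2 * \<epsilon>) * (real n)\<^sup>2 \<le> (1 / 2) * (real n)\<^sup>2"
      using \<epsilon>(1) by (intro mult_right_mono) auto
    then show ?thesis using False card(2) by linarith
  qed
qed

text \<open>The extremal construction: a matching of \<open>n div 4\<close> edges completed by the
  remaining \<open>n - 2 * (n div 4)\<close> vertices. Each pair of a matching edge and a vertex of
  \<open>C\<close> removes two pairs and adds one triple.\<close>

lemma small_saturating_antichain_exists:
  assumes "2 \<le> n"
  obtains G where "saturating_antichain_2_3 n G" "real (card G) \<le> 3 / 8 * (real n)\<^sup>2 + real n / 2"
proof -
  define k where "k = n div 4"
  define C where "C = {2 * k + 1..n}"
  define M where "M = (\<lambda>i. {i, k + i}) ` {1..k}"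
  interpret matching_context n C M
  proof
    show "C \<subseteq> {1..n}" by (auto simp: C_def)
    show "M \<subseteq> nsets ({1..n} - C) 2" by (auto simp: M_def C_def k_def)
    show "disjoint M" by (auto simp: M_def disjoint_def)
  qed
  have "inj_on (\<lambda>i. {i, k + i}) {1..k}" by (auto simp: inj_on_def doubleton_eq_iff)
  then have cM: "card M = k" by (simp add: M_def card_image)
  have cC: "card C = n - 2 * k" by (simp add: C_def)
  let ?G = "matching_family n C M"
  have "matching_family n C M \<subseteq> nsets {1..n} 2 \<union> nsets {1..n} 3"
    by (auto simp: matching_family_def matching_pairs_def matching_triples_def)
  then have sat: "saturating_antichain_2_3 n ?G"
    using saturating[OF assms] by (simp add: saturating_antichain_2_3_def)
  have "real (2 * card M * card C) \<le> real (card shadow_graph)" using card_shadow_graph unfolding of_nat_le_iff .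
  then have shadow_graph: "2 * (real (card M) * real (card C)) \<le> real (card shadow_graph)" by simp
  have ct: "real (card (triangles shadow_graph)) = real (card M) * real (card C)"
    unfolding triangles_shadow_graph card_triples by simp
  have "real (card ?G) = real (card {1..n}) * (real (card {1..n}) - 1) / 2 - real (card shadow_graph) + real (card (triangles shadow_graph))"
    unfolding family_eq by (rule card_graph_family[OF _ shadow_graph_sub]) simp
  then have cG: "real (card ?G) = real n * (real n - 1) / 2 - real (card shadow_graph) + real (card M) * real (card C)"
    unfolding ct by simp
  have up: "real (card ?G) \<le> (real n)\<^sup>2 / 2 - real n / 2 - real (card M) * real (card C)"
  proof -
    have "real n * (real n - 1) / 2 = (real n)\<^sup>2 / 2 - real n / 2"
      by (simp add: power2_eq_square field_simps)
    then show ?thesis using shadow_graph cG by linarith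
  qed
  have m: "real n / 4 - 1 \<le> real (card M)" unfolding cM k_def by linarith
  have c: "real n / 2 \<le> real (card C)" unfolding cC k_def by linarith
  have "(real n / 4 - 1) * (real n / 2) \<le> real (card M) * (real n / 2)"
    using m by (intro mult_right_mono) auto
  also have "\<dots> \<le> real (card M) * real (card C)" using c by (intro mult_left_mono) auto
  finally have "(real n)\<^sup>2 / 8 - real n / 2 \<le> real (card M) * real (card C)"
    by (simp add: power2_eq_square field_simps)
  then have "real (card ?G) \<le> 3 / 8 * (real n)\<^sup>2 + real n / 2" using up by linarith
  then show ?thesis using that sat by blast
qed

section \<open>Structure of families of nearly minimum size\<close>

lemma saturating_antichain_structure:
  fixes \<gamma> \<delta> :: real
  assumes F: "saturating_antichain_2_3 n F" and \<gamma>: "0 < \<gamma>" "\<gamma> \<le> 1 / 100" and \<delta>: "\<delta> = \<gamma>\<^sup>2 / 180"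
    and n: "3 \<le> 2 * (\<delta>\<^sup>2)\<^sup>2 * real n" and small: "real (card F) \<le> (3 / 8 + \<delta>\<^sup>2) * (real n)\<^sup>2"
  obtains A B C M where "A \<union> B \<union> C = {1..n}" "A \<inter> B = {}" "A \<inter> C = {}" "B \<inter> C = {}"
    "card A = n div 4" "card B = n div 4" "matching_between A B M"
    "saturating_antichain {1..n} (matching_family n C M)"
    "real (card (sym_diff (matching_family n C M) F)) \<le> 125 * \<gamma> * (real n)\<^sup>2"
proof -
  define V where "V = {1..n}"
  define E where "E = nsets V 2 - F"
  have V: "finite V" "E \<subseteq> nsets V 2" by (auto simp: V_def E_def)
  have cov: "\<forall>f\<in>E. \<exists>T\<in>triangles E. f \<subseteq> T"
    using saturating_antichain_2_3_graph(1)[OF F] unfolding E_def V_def .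
  have F_eq: "F = (nsets V 2 - E) \<union> triangles E"
    using saturating_antichain_2_3_graph(2)[OF F] unfolding E_def V_def .
  note card = card_saturating_antichain[OF F, folded V_def, folded E_def]
  have nV: "real n = real (card V)" by (simp add: V_def)
  have n2: "2 \<le> n" using saturating_antichain_2_3_ge_2[OF F] .
  have \<delta>0: "0 < \<delta>" using \<gamma> by (simp add: \<delta>)
  have "\<gamma>\<^sup>2 \<le> \<gamma> * (1 / 100)" unfolding power2_eq_square using \<gamma> by (intro mult_left_mono) auto
  then have \<delta>\<gamma>: "\<delta> \<le> \<gamma>" using \<delta> \<gamma> by simp
  then have \<delta>1: "\<delta> \<le> 1 / 10" using \<gamma> by simp
  have \<delta>2: "\<delta>\<^sup>2 \<le> \<delta> * (1 / 10)" unfolding power2_eq_square using \<delta>0 \<delta>1 by (intro mult_left_mono) auto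
  have "(\<delta>\<^sup>2)\<^sup>2 \<le> \<delta>\<^sup>2 * (1 / 10)"
    unfolding power2_eq_square[of "\<delta>\<^sup>2"] using \<delta>0 \<delta>1 \<delta>2 by (intro mult_left_mono) auto
  then have "2 * (\<delta>\<^sup>2)\<^sup>2 * real n \<le> 1 / 5 * \<delta>\<^sup>2 * real n" by (intro mult_right_mono) auto
  then have n_\<delta>2: "15 \<le> \<delta>\<^sup>2 * real n" using n by linarith
  have "\<delta>\<^sup>2 * real n \<le> \<gamma> * real n" using \<delta>2 \<delta>0 \<delta>\<gamma> by (intro mult_right_mono) auto
  then have n_\<gamma>: "1 \<le> \<gamma> * real n" using n_\<delta>2 by linarith
  \<comment> \<open>The linear term of \<open>n choose 2\<close> costs one further
    \<open>\<delta>^2\<close>, which is why the deficit below is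
    \<open>2 * \<delta>^2\<close>.\<close>
  have "(1 / 2) * real n \<le> \<delta>\<^sup>2 * real n * real n" using n_\<delta>2 by (intro mult_right_mono) auto
  then have half: "real n / 2 \<le> \<delta>\<^sup>2 * (real n)\<^sup>2" by (simp add: power2_eq_square)
  have npos: "real n > 0" using n2 by simp

  have "(3 / 8 + \<delta>\<^sup>2) * (real n)\<^sup>2 \<le> (1 / 2) * (real n)\<^sup>2"
    using \<delta>1 \<delta>2 by (intro mult_right_mono) auto
  then have t: "2 * real (card (triangles E)) \<le> (real n)\<^sup>2" using small card(2) by linarith
  have "real n * (real n - 1) / 2 = (real n)\<^sup>2 / 2 - real n / 2"
    by (simp add: power2_eq_square field_simps)
  then have "real (card F) = (real n)\<^sup>2 / 2 - real n / 2 - real (card E) + real (card (triangles E))"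
    using card(1) by simp
  moreover have "real (card F) \<le> 3 / 8 * (real n)\<^sup>2 + \<delta>\<^sup>2 * (real n)\<^sup>2"
    using small by (simp add: distrib_right)
  ultimately have "(real n)\<^sup>2 / 8 - 2 * (\<delta>\<^sup>2 * (real n)\<^sup>2) \<le> real (card E) - real (card (triangles E))"
    using half by linarith
  then have low: "(1 / 8 - 2 * \<delta>\<^sup>2) * (real n)\<^sup>2 \<le> real (card E) - real (card (triangles E))"
    by (simp add: left_diff_distrib)
  obtain Q where Q: "Q \<subseteq> E" "triangles Q = {}" "(1 / 4 - 9 * \<delta>) * (real n)\<^sup>2 \<le> real (card Q)"
    and e9: "real (card E) \<le> (1 / 4 + 9 * \<delta>) * (real n)\<^sup>2"
    and t9: "real (card (triangles E)) \<le> (1 / 8 + 9 * \<delta>) * (real n)\<^sup>2"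
    by (rule large_triangle_free_subgraph[OF V \<delta>0 \<delta>1 cov nV n t low])
  \<comment> \<open>The stability error \<open>9 * \<delta>\<close> is multiplied by 5 when passing
    to the bipartition. With \<open>\<delta> = \<gamma>^2 / 180\<close> this gives exactly
    \<open>4 * \<kappa> = \<gamma>^2\<close>.\<close>
  define \<kappa> where "\<kappa> = 45 * \<delta>"
  have e: "real (card E) \<le> (1 / 4 + \<kappa>) * (real n)\<^sup>2"
    using e9 by (rule order.trans) (use \<delta>0 in \<open>auto simp: \<kappa>_def intro!: mult_right_mono\<close>)
  have t': "real (card (triangles E)) \<le> (1 / 8 + \<kappa>) * (real n)\<^sup>2"
    using t9 by (rule order.trans) (use \<delta>0 in \<open>auto simp: \<kappa>_def intro!: mult_right_mono\<close>)
  have \<kappa>: "4 * \<kappa> \<le> \<gamma>\<^sup>2" by (simp add: \<kappa>_def \<delta>)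
  have QV: "Q \<subseteq> nsets V 2" using Q(1) V(2) by blast
  have "\<gamma>\<^sup>2 \<le> 1 / 100" using \<open>\<gamma>\<^sup>2 \<le> \<gamma> * (1 / 100)\<close> \<gamma> by linarith
  then have "9 * \<delta> < 1 / 4" using \<delta> by simp
  then obtain X Y where XY: "X \<union> Y = V" "X \<inter> Y = {}"
    "(1 / 4 - 5 * (9 * \<delta>)) * (real n)\<^sup>2 \<le> real (card {(x, y) \<in> X \<times> Y. {x, y} \<in> Q})"
    by (rule triangle_free_bipartition[OF V(1) QV Q(2) nV npos Q(3)])
  have fXY: "finite (X \<times> Y)" using V(1) XY(1) by (metis finite_Un finite_cartesian_product)
  have "card {(x, y) \<in> X \<times> Y. {x, y} \<in> Q} \<le> card {(x, y) \<in> X \<times> Y. {x, y} \<in> E}"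
    using Q(1) by (intro card_mono finite_subset[OF _ fXY]) auto
  then have cross: "(1 / 4 - \<kappa>) * (real n)\<^sup>2 \<le> real (card {(x, y) \<in> X \<times> Y. {x, y} \<in> E})"
    using XY(3) by (simp add: \<kappa>_def)
  note nb = near_bipartiteI[OF V XY(1,2) cov nV npos \<gamma> \<kappa> t' cross]
  obtain M where M: "M \<subseteq> E" "disjoint M"
    "\<Union> M \<subseteq> Y \<and> real (card (Y - \<Union> M)) \<le> 25 * \<gamma> * real n \<or>
     \<Union> M \<subseteq> X \<and> real (card (X - \<Union> M)) \<le> 25 * \<gamma> * real n"
    by (rule near_bipartite_matching[OF nb(1)])
  have nonedges: "real (card {(x, y) \<in> X' \<times> Y'. {x, y} \<notin> E}) \<le> \<gamma>\<^sup>2 * (real n)\<^sup>2"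
    if "near_bipartite V E X' Y' (real n) \<gamma>" "finite (X' \<times> Y')" for X' Y'
  proof -
    have "card {(x, y) \<in> X' \<times> Y'. {x, y} \<notin> E} \<le> card {(x, y) \<in> X' \<times> Y'. \<not> good_pair E x y}"
      by (intro card_mono finite_subset[OF _ that(2)]) (auto simp: good_pair_def)
    then show ?thesis using near_bipartite.bad_pairs[OF that(1)] by linarith
  qed
  have n0: "0 < n" using n2 by simp
  have V': "E \<subseteq> nsets {1..n} 2" using V(2) by (simp add: V_def)
  have fYX: "finite (Y \<times> X)" using V(1) XY(1) by (metis finite_Un finite_cartesian_product)
  have YX: "Y \<union> X = V" using XY(1) by blast
  from M(3) show ?thesis
  proof
    assume m: "\<Union> M \<subseteq> Y \<and> real (card (Y - \<Union> M)) \<le> 25 * \<gamma> * real n"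
    show ?thesis
      by (rule matching_family_close[OF V' M(1,2) XY(1)[unfolded V_def] conjunct1[OF m] n0 n_\<gamma> n2 \<gamma> \<kappa> nb(3)
            conjunct2[OF m] nonedges[OF nb(1) fXY] e t'])
        (rule that, (simp only: V_def F_eq)+)
  next
    assume m: "\<Union> M \<subseteq> X \<and> real (card (X - \<Union> M)) \<le> 25 * \<gamma> * real n"
    show ?thesis
      by (rule matching_family_close[OF V' M(1,2) YX[unfolded V_def] conjunct1[OF m] n0 n_\<gamma> n2 \<gamma> \<kappa> nb(2)
            conjunct2[OF m] nonedges[OF near_bipartite.swap_sides[OF nb(1)] fYX] e t'])
        (rule that, (simp only: V_def F_eq)+)
  qed
qed

text \<open>With the empty matching the family consists of all pairs. This supplies a valid
  partition for small \<open>n\<close>, where the stability argument says nothing.\<close>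

lemma matching_family_exists:
  assumes "2 \<le> n"
  obtains A B C M where "A \<union> B \<union> C = {1..n}" "A \<inter> B = {}" "A \<inter> C = {}" "B \<inter> C = {}"
    "card A = n div 4" "card B = n div 4" "matching_between A B M"
    "saturating_antichain {1..n} (matching_family n C M)"
proof -
  obtain A B where AB: "A \<subseteq> {1..n}" "B \<subseteq> {1..n}" "A \<inter> B = {}" "card A = n div 4" "card B = n div 4"
    "matching_between A B {}"
  proof (rule matching_partition)
    show "finite {1..n}" "({} :: nat set set) \<subseteq> nsets {1..n} 2" "disjoint ({} :: nat set set)"
      "card ({} :: nat set set) \<le> n div 4" "2 * (n div 4) \<le> card {1..n}"
      by (simp_all add: disjoint_def)
  qed
  interpret matching_context n "{1..n} - (A \<union> B)" "{}"
    by unfold_locales (auto simp: disjoint_def)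
  show ?thesis
    using that[of A B "{1..n} - (A \<union> B)" "{}"] AB saturating[OF assms] by blast
qed

section \<open>Passage to o-notation\<close>

lemma smallo_1I:
  fixes f :: "nat \<Rightarrow> real"
  assumes "\<And>c. 0 < c \<Longrightarrow> \<exists>N. \<forall>n\<ge>N. \<bar>f n\<bar> \<le> c"
  shows "f \<in> o(\<lambda>_. 1)"
proof (rule landau_o.smallI)
  fix c :: real assume "0 < c"
  then obtain N where "\<forall>n\<ge>N. \<bar>f n\<bar> \<le> c" using assms by blast
  then show "eventually (\<lambda>n. norm (f n) \<le> c * norm (1 :: real)) sequentially"
    by (auto simp: eventually_sequentially)
qed

text \<open>The lower bound on saturating antichains controls \<open>\<epsilon>\<close> from above,
  comparison with the explicit construction controls it from below.\<close>

lemma minimum_size_asymptotics: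
  fixes F :: "nat \<Rightarrow> nat set set"
  assumes F: "\<forall>n\<ge>N. is_arg_min card (saturating_antichain_2_3 n) (F n)"
  shows "\<exists>\<epsilon> :: nat \<Rightarrow> real. \<epsilon> \<in> o(\<lambda>_. 1) \<and> (\<forall>n\<ge>N. real (card (F n)) = (3/8 - \<epsilon> n) * (real n)\<^sup>2)"
proof -
  define \<epsilon> where "\<epsilon> n = 3/8 - real (card (F n)) / (real n)\<^sup>2" for n
  have sat: "saturating_antichain_2_3 n (F n)" if "n \<ge> N" for n
    using F that by (auto simp: is_arg_min_def)
  have "\<epsilon> \<in> o(\<lambda>_. 1)"
  proof (rule smallo_1I)
    fix c :: real assume c: "0 < c"
    define \<eta> where "\<eta> = min (1 / 2) (c * 2 / 5)"
    have \<eta>: "0 < \<eta>" "\<eta> \<le> 1 / 2" "5 / 2 * \<eta> \<le> c" using c by (auto simp: \<eta>_def)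
    obtain N1 :: nat where N1: "3 / (2 * \<eta>\<^sup>2) \<le> real N1" using real_arch_simple by blast
    obtain N2 :: nat where N2: "1 / (2 * c) \<le> real N2" using real_arch_simple by blast
    have "\<bar>\<epsilon> n\<bar> \<le> c" if n: "n \<ge> max N (max N1 N2)" for n
    proof -
      have nN: "n \<ge> N" and n1: "real N1 \<le> real n" and n2: "real N2 \<le> real n" using n by auto
      have "2 \<le> n" using saturating_antichain_2_3_ge_2[OF sat[OF nN]] .
      then have sq: "(real n)\<^sup>2 > 0" by simp
      have "3 / (2 * \<eta>\<^sup>2) \<le> real n" using N1 n1 by linarith
      then have "3 \<le> 2 * \<eta>\<^sup>2 * real n" using \<eta>(1) by (simp add: divide_le_eq mult.commute)
      then have "(3 / 8 - 5 / 2 * \<eta>) * (real n)\<^sup>2 \<le> real (card (F n))"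
        by (rule saturating_antichain_lower_bound[OF sat[OF nN] \<eta>(1,2)])
      then have "3 / 8 - 5 / 2 * \<eta> \<le> real (card (F n)) / (real n)\<^sup>2"
        using sq by (simp add: le_divide_eq)
      then have up: "\<epsilon> n \<le> c" using \<eta>(3) unfolding \<epsilon>_def by linarith
      obtain G where G: "saturating_antichain_2_3 n G" "real (card G) \<le> 3 / 8 * (real n)\<^sup>2 + real n / 2"
        using small_saturating_antichain_exists[OF \<open>2 \<le> n\<close>] .
      have "card (F n) \<le> card G"
        using F nN G(1) by (auto simp: is_arg_min_def not_less)
      then have "real (card (F n)) \<le> 3 / 8 * (real n)\<^sup>2 + real n / 2" using G(2) by linarith
      also have "1 / (2 * c) \<le> real n" using N2 n2 by linarith
      then have "1 / 2 \<le> c * real n" using c by (simp add: divide_le_eq mult_ac)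
      then have "1 / 2 * real n \<le> c * real n * real n" by (rule mult_right_mono) simp
      then have "3 / 8 * (real n)\<^sup>2 + real n / 2 \<le> (3 / 8 + c) * (real n)\<^sup>2"
        by (simp add: power2_eq_square distrib_right)
      finally have "real (card (F n)) / (real n)\<^sup>2 \<le> 3 / 8 + c"
        using sq by (simp add: divide_le_eq)
      then show ?thesis using up unfolding \<epsilon>_def by linarith
    qed
    then show "\<exists>N. \<forall>n\<ge>N. \<bar>\<epsilon> n\<bar> \<le> c" by blast
  qed
  moreover have "real (card (F n)) = (3/8 - \<epsilon> n) * (real n)\<^sup>2" if "n \<ge> N" for n
    using saturating_antichain_2_3_ge_2[OF sat[OF that]] by (simp add: \<epsilon>_def)
  ultimately show ?thesis by blast
qed

definition matching_partition_family :: "nat \<Rightarrow> nat set \<times> nat set \<times> nat set \<times> nat set set \<Rightarrow> bool" where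
  "matching_partition_family n = (\<lambda>(A, B, C, M).
     A \<union> B \<union> C = {1..n} \<and> A \<inter> B = {} \<and> A \<inter> C = {} \<and> B \<inter> C = {} \<and>
     card A = n div 4 \<and> card B = n div 4 \<and> matching_between A B M \<and>
     saturating_antichain {1..n} (matching_family n C M))"

text \<open>The structure lemma yields a partition depending on the accuracy
  \<open>\<gamma>\<close>. To get one partition for each \<open>n\<close>, one minimising the
  distance to \<open>F n\<close> is chosen; it is at least as close as every approximation, whatever
  the accuracy.\<close>

lemma near_minimum_structure:
  fixes F :: "nat \<Rightarrow> nat set set" and \<epsilon> :: "nat \<Rightarrow> real"
  assumes F: "\<forall>n\<ge>N. saturating_antichain_2_3 n (F n)"
    and \<epsilon>: "\<epsilon> \<in> o(\<lambda>_. 1)" and card_F: "\<forall>n\<ge>N. real (card (F n)) = (3/8 + \<epsilon> n) * (real n)\<^sup>2"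
  obtains p where "\<forall>n\<ge>N. matching_partition_family n (p n)"
    "(\<lambda>n. real (card (sym_diff (case p n of (A, B, C, M) \<Rightarrow> matching_family n C M) (F n)))) \<in> o(\<lambda>n. (real n)\<^sup>2)"
proof -
  define cost where
    "cost n q = card (sym_diff (case q of (A, B, C, M) \<Rightarrow> matching_family n C M) (F n))"
    for n and q :: "nat set \<times> nat set \<times> nat set \<times> nat set set"
  have "\<exists>q. matching_partition_family n q \<and> (\<forall>q'. matching_partition_family n q' \<longrightarrow> cost n q \<le> cost n q')"
    if "n \<ge> N" for n
  proof -
    have "2 \<le> n" using saturating_antichain_2_3_ge_2 F that by blast
    then obtain A B C M where "matching_partition_family n (A, B, C, M)"
      by (rule matching_family_exists) (simp add: matching_partition_family_def)
    then show ?thesis by (rule ex_has_least_nat)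
  qed
  then obtain p where p: "\<And>n. n \<ge> N \<Longrightarrow> matching_partition_family n (p n)"
    and min: "\<And>n q. n \<ge> N \<Longrightarrow> matching_partition_family n q \<Longrightarrow> cost n (p n) \<le> cost n q"
    by metis
  have "(\<lambda>n. real (cost n (p n))) \<in> o(\<lambda>n. (real n)\<^sup>2)"
  proof (rule landau_o.smallI)
    fix c :: real assume c: "0 < c"
    define \<gamma> where "\<gamma> = min (1 / 100) (c / 125)"
    have \<gamma>: "0 < \<gamma>" "\<gamma> \<le> 1 / 100" "125 * \<gamma> \<le> c" using c by (auto simp: \<gamma>_def)
    define \<delta> where "\<delta> = \<gamma>\<^sup>2 / 180"
    have \<delta>: "\<delta>\<^sup>2 > 0" "(\<delta>\<^sup>2)\<^sup>2 > 0" using \<gamma>(1) by (simp_all add: \<delta>_def)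
    obtain N1 :: nat where N1: "3 / (2 * (\<delta>\<^sup>2)\<^sup>2) \<le> real N1" using real_arch_simple by blast
    have "eventually (\<lambda>n. norm (\<epsilon> n) \<le> \<delta>\<^sup>2 * norm (1 :: real)) sequentially"
      by (rule landau_o.smallD[OF \<epsilon> \<delta>(1)])
    then have "eventually (\<lambda>n. norm (\<epsilon> n) \<le> \<delta>\<^sup>2 * norm (1 :: real) \<and> max N N1 \<le> n) sequentially"
      using eventually_ge_at_top[of "max N N1"] by (rule eventually_conj)
    then show "eventually (\<lambda>n. norm (real (cost n (p n))) \<le> c * norm ((real n)\<^sup>2)) sequentially"
    proof (rule eventually_mono)
      fix n assume n: "norm (\<epsilon> n) \<le> \<delta>\<^sup>2 * norm (1 :: real) \<and> max N N1 \<le> n"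
      then have nN: "n \<ge> N" and \<epsilon>n: "\<epsilon> n \<le> \<delta>\<^sup>2" and "real N1 \<le> real n" by auto
      then have "3 / (2 * (\<delta>\<^sup>2)\<^sup>2) \<le> real n" using N1 by linarith
      then have n_large: "3 \<le> 2 * (\<delta>\<^sup>2)\<^sup>2 * real n"
        using \<delta>(2) by (simp add: divide_le_eq mult.commute)
      have "(3 / 8 + \<epsilon> n) * (real n)\<^sup>2 \<le> (3 / 8 + \<delta>\<^sup>2) * (real n)\<^sup>2"
        using \<epsilon>n by (intro mult_right_mono) auto
      then have small: "real (card (F n)) \<le> (3 / 8 + \<delta>\<^sup>2) * (real n)\<^sup>2"
        using card_F nN by simp
      have "saturating_antichain_2_3 n (F n)" using F nN by blast
      then obtain A B C M where q: "A \<union> B \<union> C = {1..n}" "A \<inter> B = {}" "A \<inter> C = {}" "B \<inter> C = {}"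
        "card A = n div 4" "card B = n div 4" "matching_between A B M"
        "saturating_antichain {1..n} (matching_family n C M)"
        "real (card (sym_diff (matching_family n C M) (F n))) \<le> 125 * \<gamma> * (real n)\<^sup>2"
        by (rule saturating_antichain_structure[OF _ \<gamma>(1,2) \<delta>_def n_large small])
      have "matching_partition_family n (A, B, C, M)"
        using q(1-8) unfolding matching_partition_family_def by simp
      then have "cost n (p n) \<le> cost n (A, B, C, M)" by (rule min[OF nN])
      then have "real (cost n (p n)) \<le> 125 * \<gamma> * (real n)\<^sup>2"
        using q(9) unfolding cost_def by simp
      also have "\<dots> \<le> c * (real n)\<^sup>2" using \<gamma>(3) by (intro mult_right_mono) auto
      finally show "norm (real (cost n (p n))) \<le> c * norm ((real n)\<^sup>2)" by simp
    qed
  qed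
  then show ?thesis using that[of p] p unfolding cost_def by blast
qed

theorem theorem5:
  shows "(\<forall>(F :: nat \<Rightarrow> nat set set) N.
            (\<forall>n\<ge>N. is_arg_min card (saturating_antichain_2_3 n) (F n)) \<longrightarrow>
            (\<exists>\<epsilon> :: nat \<Rightarrow> real. \<epsilon> \<in> o(\<lambda>_. 1) \<and>
               (\<forall>n\<ge>N. real (card (F n)) = (3/8 - \<epsilon> n) * (real n)\<^sup>2)))
       \<and> (\<forall>(F :: nat \<Rightarrow> nat set set) N.
            (\<forall>n\<ge>N. saturating_antichain_2_3 n (F n)) \<longrightarrow>
            (\<exists>\<epsilon> :: nat \<Rightarrow> real. \<epsilon> \<in> o(\<lambda>_. 1) \<and>
               (\<forall>n\<ge>N. real (card (F n)) = (3/8 + \<epsilon> n) * (real n)\<^sup>2)) \<longrightarrow>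
            (\<exists>(A :: nat \<Rightarrow> nat set) (B :: nat \<Rightarrow> nat set) (C :: nat \<Rightarrow> nat set) (M :: nat \<Rightarrow> nat set set).
               (\<forall>n\<ge>N. A n \<union> B n \<union> C n = {1..n} \<and>
                       A n \<inter> B n = {} \<and> A n \<inter> C n = {} \<and> B n \<inter> C n = {} \<and>
                       card (A n) = n div 4 \<and> card (B n) = n div 4 \<and>
                       matching_between (A n) (B n) (M n) \<and>
                       saturating_antichain {1..n} (matching_family n (C n) (M n))) \<and>
               (\<lambda>n. real (card (sym_diff (matching_family n (C n) (M n)) (F n)))) \<in> o(\<lambda>n. (real n)\<^sup>2)))"
proof (intro conjI allI impI; (elim exE conjE)?)
  fix F :: "nat \<Rightarrow> nat set set" and N
  assume "\<forall>n\<ge>N. is_arg_min card (saturating_antichain_2_3 n) (F n)"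
  then show "\<exists>\<epsilon> :: nat \<Rightarrow> real. \<epsilon> \<in> o(\<lambda>_. 1) \<and> (\<forall>n\<ge>N. real (card (F n)) = (3/8 - \<epsilon> n) * (real n)\<^sup>2)"
    by (rule minimum_size_asymptotics)
next
  fix F :: "nat \<Rightarrow> nat set set" and N and \<epsilon> :: "nat \<Rightarrow> real"
  assume "\<forall>n\<ge>N. saturating_antichain_2_3 n (F n)" "\<epsilon> \<in> o(\<lambda>_. 1)"
    "\<forall>n\<ge>N. real (card (F n)) = (3/8 + \<epsilon> n) * (real n)\<^sup>2"
  then obtain p where p: "\<forall>n\<ge>N. matching_partition_family n (p n)"
    "(\<lambda>n. real (card (sym_diff (case p n of (A, B, C, M) \<Rightarrow> matching_family n C M) (F n)))) \<in> o(\<lambda>n. (real n)\<^sup>2)"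
    by (rule near_minimum_structure)
  show "\<exists>A B C M.
      (\<forall>n\<ge>N. A n \<union> B n \<union> C n = {1..n} \<and>
        A n \<inter> B n = {} \<and> A n \<inter> C n = {} \<and> B n \<inter> C n = {} \<and>
        card (A n) = n div 4 \<and> card (B n) = n div 4 \<and>
        matching_between (A n) (B n) (M n) \<and>
        saturating_antichain {1..n} (matching_family n (C n) (M n))) \<and>
      (\<lambda>n. real (card (sym_diff (matching_family n (C n) (M n)) (F n)))) \<in> o(\<lambda>n. (real n)\<^sup>2)"
    by (rule exI[of _ "\<lambda>n. fst (p n)"], rule exI[of _ "\<lambda>n. fst (snd (p n))"],
        rule exI[of _ "\<lambda>n. fst (snd (snd (p n)))"], rule exI[of _ "\<lambda>n. snd (snd (snd (p n)))"])
      (use p in \<open>simp add: matching_partition_family_def case_prod_beta\<close>)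
qed

end
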